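(* For every integer $n\ge 1$, the sandpile group of the Kautz graph $\mathrm{Kautz}_n$ satisfies $$K(\mathrm{Kautz}_n)\cong(\mathbb{Z}/3\mathbb{Z})\oplus(\mathbb{Z}/2^{n-1}\mathbb{Z})^2\oplus\bigoplus_{j=1}^{n-2}(\mathbb{Z}/2^j\mathbb{Z})^{3\cdot 2^{\,n-2-j}},$$ where an empty direct sum is the trivial group.
   Context: For a finite directed graph $G=(V,E)$ (loops and multiple edges allowed) with source and target maps $\mathtt{s},\mathtt{t}:E\to V$, the directed line graph $\mathcal{L}G=(E,E_2)$ has vertex set $E$ and edge set $E_2=\{(e_1,e_2)\in E\times E:\mathtt{s}(e_2)=\mathtt{t}(e_1)\}$, with $(e_1,e_2)$ directed from $e_1$ to $e_2$. The Kautz graphs are defined by: $\mathrm{Kautz}_1$ is the directed graph with vertex set $\{1,2,3\}$ and edge set $\{(1,2),(1,3),(2,1),(2,3),(3,1),(3,2)\}$, and $\mathrm{Kautz}_n=\mathcal{L}(\mathrm{Kautz}_{n-1})$ for $n\ge2$. Sandpile group: for a strongly connected finite directed graph $G=(V,E)$ and a vertex $v_*$, let $\Delta_v=\sum_{\mathtt{s}(e)=v}(\mathtt{t}(e)-v)\in\mathbb{Z}^V$ for $v\in V$, let $L_V\subset\mathbb{Z}^V$ be the subgroup generated by $v_*$ and $\{\Delta_v\}_{v\neq v_*}$, and define $K(G,v_* )=\mathbb{Z}^V/L_V$. If $G$ is Eulerian (the indegree equals the outdegree at every vertex), the groups $K(G,v_* )$ for different choices of $v_*$ are isomorphic, and the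 sandpile group is denoted $K(G)$. Each $\mathrm{Kautz}_n$ is strongly connected and Eulerian. *)

theory Defs
  imports "HOL-Algebra.Algebra" "Graph_Theory.Digraph"
begin

text \<open>
  Iterating the line graph construction changes the type of the vertices at every step, from
  \<open>'e\<close> to \<open>'e \<times> 'e\<close>. To keep all the graphs in a single type, ordered pairs of edges are
  represented by the free constructor \<open>OPair\<close>, whose components are \<open>opfst\<close> and \<open>opsnd\<close>.
\<close>

datatype 'a nested = Atom 'a | OPair (opfst: "'a nested") (opsnd: "'a nested")

definition line_digraph ::
    "('v, 'a nested) pre_digraph \<Rightarrow> ('a nested, 'a nested) pre_digraph" where
  "line_digraph G =
     \<lparr> verts = arcs G,
       arcs = {OPair e1 e2 | e1 e2. e1 \<in> arcs G \<and> e2 \<in> arcs G \<and> tail G e2 = head G e1},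
       tail = opfst,
       head = opsnd \<rparr>"

definition kautz1 :: "(nat nested, nat nested) pre_digraph" where
  "kautz1 =
     \<lparr> verts = Atom ` {1, 2, 3},
       arcs = (\<lambda>(i, j). OPair (Atom i) (Atom j)) `
         {(1, 2), (1, 3), (2, 1), (2, 3), (3, 1), (3, 2)},
       tail = opfst,
       head = opsnd \<rparr>"

text \<open>Only the values for \<open>n \<ge> 1\<close> are meaningful; \<open>kautz 0\<close> is \<open>kautz 1\<close>.\<close>

definition kautz :: "nat \<Rightarrow> (nat nested, nat nested) pre_digraph" where
  "kautz n = (line_digraph ^^ (n - 1)) kautz1"

lemma kautz_1: "kautz 1 = kautz1"
  by (simp add: kautz_def)

lemma kautz_rec: "n \<ge> 2 \<Longrightarrow> kautz n = line_digraph (kautz (n - 1))"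
  by (cases "n - 1") (simp_all add: kautz_def)

definition sandpile_delta :: "('v, 'e) pre_digraph \<Rightarrow> 'v \<Rightarrow> 'v \<Rightarrow>\<^sub>0 int" where
  "sandpile_delta G v =
     (\<Sum>e \<in> {e \<in> arcs G. tail G e = v}. frag_of (head G e) - frag_of v)"

definition sandpile_lattice :: "('v, 'e) pre_digraph \<Rightarrow> 'v \<Rightarrow> ('v \<Rightarrow>\<^sub>0 int) set" where
  "sandpile_lattice G r =
     generate (free_Abelian_group (verts G))
       (insert (frag_of r) (sandpile_delta G ` (verts G - {r})))"

definition sandpile_group :: "('v, 'e) pre_digraph \<Rightarrow> 'v \<Rightarrow> ('v \<Rightarrow>\<^sub>0 int) set monoid" where
  "sandpile_group G r = free_Abelian_group (verts G) Mod sandpile_lattice G r"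

end

theory Submission
  imports Defs
begin

text \<open>
  Let \<open>coker G\<close> be the abelian group generated by the vertices of \<open>G\<close> with one relation
  \<open>2 v = v' + v''\<close> for each vertex \<open>v\<close>, where \<open>v'\<close>, \<open>v''\<close> are the two out-neighbours of \<open>v\<close>.
  It is the sandpile group with an extra infinite cyclic summand, which is detected by the degree.
  So the proof decomposes \<open>coker (Kautz n)\<close> into cyclic groups and removes the summand at the end
  (\<open>presented_group_degree_zero\<close>).

  The decomposition rests on a family of groups that is closed under passing to line graphs.
  Choose for every vertex \<open>v\<close> an out-neighbour \<open>c v\<close>, and let \<open>A k G\<close> be obtained from \<open>coker G\<close>,
  with generators \<open>g v\<close>, by adjoining for every \<open>v\<close> an element \<open>a v\<close> with \<open>2^k a v = g (c v)\<close>.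
  Here \<open>A 0 G\<close> is \<open>coker G\<close> itself. In the line graph \<open>L\<close> of \<open>G\<close>, let \<open>p v\<close> and \<open>q v\<close> be the arcs out of \<open>v\<close>,
  where \<open>p v\<close> ends in \<open>c v\<close>, and choose for an arc \<open>e\<close> the out-neighbour \<open>p w\<close>, where \<open>w\<close> is the head of \<open>e\<close>.
  Every chosen \<open>p w\<close> is then hit by exactly the two arcs \<open>i w\<close>, \<open>j w\<close> into \<open>w\<close>. Therefore:

  \<^item> the difference \<open>a (j w) - a (i w)\<close> has order \<open>2^k\<close> and splits off a cyclic summand;
  \<^item> the generator \<open>g (p w)\<close> can be eliminated in favour of \<open>2^k a (i w)\<close>;
  \<^item> the relations of \<open>L\<close> make \<open>2 g e\<close> the sum \<open>g (p w) + g (q w)\<close> over the head \<open>w\<close> of \<open>e\<close>; these sums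
    obey the relations of \<open>G\<close>, and the relation at \<open>e = p v\<close> turns \<open>2^k a (i v) = g (p v)\<close> into
    \<open>2^(k+1) a (i v) = g (c v)\<close>.

  This gives \<open>A k L = A (k+1) G \<oplus> (\<int>/2^k)^V\<close> (\<open>divided_group_line_iso\<close>). Starting from
  \<open>A 0 (Kautz n)\<close> and descending to the triangle, the number of vertices halves at each step, which yields
  the summands \<open>(\<int>/2^j)^(3 * 2^(n-2-j))\<close>; those with \<open>j = 0\<close> are trivial. What remains is \<open>A (n-1)\<close>
  of the triangle. If \<open>c\<close> rotates the triangle then all \<open>g v\<close> are eliminated. This leaves
  the cokernel of \<open>2^(n-1)\<close> times the Laplacian of the triangle, and this Laplacian has the invariant
  factors \<open>1, 3, 0\<close>.
  The cokernel is \<open>\<int> \<oplus> \<int>/3 \<oplus> (\<int>/2^(n-1))^2\<close> (\<open>divided_group_triangle_iso\<close>).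

  The line graph step and the triangle are isomorphisms between groups given by generators and relations.
  Such an isomorphism is proved by giving images of the generators in both directions
  (\<open>presented_group_isoI\<close>), without computing a kernel.
\<close>

section \<open>Abelian groups given by generators and relations\<close>

interpretation frag: Modules.module frag_cmul
  by unfold_locales (simp_all add: frag_cmul_distrib frag_cmul_distrib2)

text \<open>A subgroup of a free abelian group is a submodule over the integers, and so the linear algebra of
  spans is available for relation subgroups.\<close>

lemma span_eq_generate:
  assumes "R \<subseteq> carrier (free_Abelian_group A)"
  shows "generate (free_Abelian_group A) R = frag.span R"
proof -
  let ?F = "free_Abelian_group A"
  interpret F: group ?F by simp
  have sub: "subgroup (generate ?F R) ?F"
    by (rule F.generate_is_subgroup [OF assms])
  have keys: "Poly_Mapping.keys x \<subseteq> A" if "x \<in> generate ?F R" for x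
    using subgroup.mem_carrier [OF sub that] by simp
  have diff: "x - y \<in> generate ?F R" if "x \<in> generate ?F R" "y \<in> generate ?F R" for x y
  proof -
    have "x \<otimes>\<^bsub>?F\<^esub> inv\<^bsub>?F\<^esub> y \<in> generate ?F R"
      by (intro subgroup.m_closed [OF sub] subgroup.m_inv_closed [OF sub] that)
    then show ?thesis
      using keys [OF that(2)] by simp
  qed
  have zero: "0 \<in> generate ?F R"
    using subgroup.one_closed [OF sub] by simp
  have "frag.subspace (generate ?F R)"
    unfolding frag.subspace_def
  proof (intro conjI ballI allI)
    fix x y c assume x: "x \<in> generate ?F R"
    show "frag_cmul c x \<in> generate ?F R"
      by (rule frag_closure_minus_cmul [of "\<lambda>x. x \<in> generate ?F R"]) (use x zero diff in auto)
    assume y: "y \<in> generate ?F R"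
    show "x + y \<in> generate ?F R"
      using diff [OF x diff [OF zero y]] by simp
  qed (rule zero)
  moreover have "R \<subseteq> generate ?F R"
    by (auto intro: generate.incl)
  ultimately have "frag.span R \<subseteq> generate ?F R"
    by (simp add: frag.span_minimal)
  moreover have "x \<in> frag.span R" if "x \<in> generate ?F R" for x
    using that
  proof induction
    case (inv h)
    then show ?case
      using assms frag.span_neg [OF frag.span_base [OF inv]] by auto
  qed (auto intro: frag.span_base frag.span_add frag.span_zero)
  ultimately show ?thesis
    by blast
qed

definition presented_group :: "'a set \<Rightarrow> ('a \<Rightarrow>\<^sub>0 int) set \<Rightarrow> ('a \<Rightarrow>\<^sub>0 int) set monoid" where
  "presented_group A R = free_Abelian_group A Mod frag.span R"

lemma normal_span:
  assumes "R \<subseteq> carrier (free_Abelian_group A)"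
  shows "frag.span R \<lhd> free_Abelian_group A"
  using group.generate_is_subgroup [OF group_free_Abelian_group assms]
  by (simp add: span_eq_generate [OF assms] comm_group.normal_iff_subgroup [OF abelian_free_Abelian_group])

lemma group_presented_group [simp]:
  "R \<subseteq> carrier (free_Abelian_group A) \<Longrightarrow> group (presented_group A R)"
  unfolding presented_group_def by (intro normal.factorgroup_is_group normal_span)

lemma presented_group_iso_if_epi:
  assumes "group T" and \<phi>: "\<phi> \<in> hom (free_Abelian_group A) T"
    and surj: "carrier T \<subseteq> \<phi> ` carrier (free_Abelian_group A)"
    and R: "R \<subseteq> carrier (free_Abelian_group A)"
    and ker: "\<And>x. Poly_Mapping.keys x \<subseteq> A \<Longrightarrow> \<phi> x = \<one>\<^bsub>T\<^esub> \<longleftrightarrow> x \<in> frag.span R"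
  shows "presented_group A R \<cong> T"
proof -
  interpret \<phi>: group_hom "free_Abelian_group A" T \<phi>
    using assms by (simp add: group_hom_def group_hom_axioms_def)
  have "kernel (free_Abelian_group A) T \<phi> = frag.span R"
    using ker subgroup.subset [OF normal_imp_subgroup [OF normal_span [OF R]]]
    by (auto simp: kernel_def subset_iff)
  moreover have "\<phi> ` carrier (free_Abelian_group A) = carrier T"
    using surj \<phi>.hom_closed by blast
  ultimately show ?thesis
    using \<phi>.FactGroup_iso by (simp add: presented_group_def)
qed

lemma epi_presented_group:
  assumes R: "R \<subseteq> carrier (free_Abelian_group A)"
  shows "(\<lambda>x. frag.span R #>\<^bsub>free_Abelian_group A\<^esub> x) \<in> hom (free_Abelian_group A) (presented_group A R)"
    and "carrier (presented_group A R) =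
      (\<lambda>x. frag.span R #>\<^bsub>free_Abelian_group A\<^esub> x) ` carrier (free_Abelian_group A)"
    and "Poly_Mapping.keys x \<subseteq> A \<Longrightarrow>
      frag.span R #>\<^bsub>free_Abelian_group A\<^esub> x = \<one>\<^bsub>presented_group A R\<^esub> \<longleftrightarrow> x \<in> frag.span R"
proof -
  interpret normal "frag.span R" "free_Abelian_group A"
    by (rule normal_span [OF R])
  show "(\<lambda>x. frag.span R #>\<^bsub>free_Abelian_group A\<^esub> x) \<in> hom (free_Abelian_group A) (presented_group A R)"
    unfolding presented_group_def by (rule r_coset_hom_Mod)
  show "carrier (presented_group A R) =
      (\<lambda>x. frag.span R #>\<^bsub>free_Abelian_group A\<^esub> x) ` carrier (free_Abelian_group A)"
    by (simp add: presented_group_def carrier_FactGroup)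
  show "frag.span R #>\<^bsub>free_Abelian_group A\<^esub> x = \<one>\<^bsub>presented_group A R\<^esub> \<longleftrightarrow> x \<in> frag.span R"
    if "Poly_Mapping.keys x \<subseteq> A"
    using that coset_join1 coset_join2 subgroup_axioms subset
    by (simp add: presented_group_def) (metis carrier_free_Abelian_group_iff)
qed

text \<open>For computations with elements, an isomorphism is best replaced by the induced epimorphism
  from the free group, whose kernel is the relation subgroup.\<close>

lemma epi_if_presented_group_iso:
  assumes "presented_group A R \<cong> T" "group T" and R: "R \<subseteq> carrier (free_Abelian_group A)"
  obtains \<phi> where "\<phi> \<in> hom (free_Abelian_group A) T"
    and "carrier T \<subseteq> \<phi> ` carrier (free_Abelian_group A)"
    and "\<And>x. Poly_Mapping.keys x \<subseteq> A \<Longrightarrow> \<phi> x = \<one>\<^bsub>T\<^esub> \<longleftrightarrow> x \<in> frag.span R"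
proof -
  obtain h where h: "h \<in> iso (presented_group A R) T"
    using assms by (auto simp: is_iso_def)
  let ?c = "\<lambda>x. frag.span R #>\<^bsub>free_Abelian_group A\<^esub> x"
  note c = epi_presented_group [OF R]
  have hom: "h \<in> hom (presented_group A R) T" and bij: "bij_betw h (carrier (presented_group A R)) (carrier T)"
    using h by (auto simp: iso_def)
  interpret h: group_hom "presented_group A R" T h
    using assms hom by (simp add: group_hom_def group_hom_axioms_def)
  show ?thesis
  proof
    show "h \<circ> ?c \<in> hom (free_Abelian_group A) T"
      using hom c(1) by (rule hom_compose [rotated])
    show "carrier T \<subseteq> (h \<circ> ?c) ` carrier (free_Abelian_group A)"
      using bij unfolding c(2) bij_betw_def by (auto simp: image_comp)
    fix x :: "'a \<Rightarrow>\<^sub>0 int" assume x: "Poly_Mapping.keys x \<subseteq> A"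
    then have "?c x \<in> carrier (presented_group A R)"
      unfolding c(2) by simp
    then have "h (?c x) = \<one>\<^bsub>T\<^esub> \<longleftrightarrow> ?c x = \<one>\<^bsub>presented_group A R\<^esub>"
      using bij h.hom_one h.G.one_closed unfolding bij_betw_def by (metis inj_onD)
    then show "(h \<circ> ?c) x = \<one>\<^bsub>T\<^esub> \<longleftrightarrow> x \<in> frag.span R"
      using c(3) [OF x] by simp
  qed
qed

lemma frag_extend_closed:
  assumes "\<And>x. x \<in> A \<Longrightarrow> Poly_Mapping.keys (f x) \<subseteq> B" "Poly_Mapping.keys x \<subseteq> A"
  shows "Poly_Mapping.keys (frag_extend f x) \<subseteq> B"
  using assms keys_frag_extend [of f x] by blast

lemma frag_extend_span:
  assumes "\<And>r. r \<in> R \<Longrightarrow> frag_extend f r \<in> frag.span S" "x \<in> frag.span R"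
  shows "frag_extend f x \<in> frag.span S"
  using assms(2)
  by (induction rule: frag.span_induct_alt)
    (auto simp: frag_extend_add frag_extend_cmul intro!: assms(1) frag.span_zero frag.span_add frag.span_scale)

lemma frag_extend_section:
  assumes "\<And>x. x \<in> A \<Longrightarrow> frag_extend g (f x) - frag_of x \<in> frag.span R"
    and "Poly_Mapping.keys x \<subseteq> A"
  shows "frag_extend g (frag_extend f x) - x \<in> frag.span R"
  using assms(2)
proof (induction rule: frag_induction)
  case (diff a b)
  have "frag_extend g (frag_extend f (a - b)) - (a - b) =
      (frag_extend g (frag_extend f a) - a) - (frag_extend g (frag_extend f b) - b)"
    by (simp add: frag_extend_diff)
  then show ?case
    using diff by (simp only: frag.span_diff)
qed (use assms in \<open>auto intro: frag.span_zero\<close>)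

text \<open>The induced map from \<open>A\<close> is onto because of \<open>fg\<close>, and its kernel is the span of \<open>R\<close> because an
  element \<open>x\<close> differs from its image under both maps only by relations. All hypotheses concern
  generators and relators only.\<close>

lemma presented_group_isoI:
  assumes R: "R \<subseteq> carrier (free_Abelian_group A)" and S: "S \<subseteq> carrier (free_Abelian_group B)"
    and f: "\<And>x. x \<in> A \<Longrightarrow> Poly_Mapping.keys (f x) \<subseteq> B"
    and g: "\<And>y. y \<in> B \<Longrightarrow> Poly_Mapping.keys (g y) \<subseteq> A"
    and fR: "\<And>r. r \<in> R \<Longrightarrow> frag_extend f r \<in> frag.span S"
    and gS: "\<And>s. s \<in> S \<Longrightarrow> frag_extend g s \<in> frag.span R"
    and gf: "\<And>x. x \<in> A \<Longrightarrow> frag_extend g (f x) - frag_of x \<in> frag.span R"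
    and fg: "\<And>y. y \<in> B \<Longrightarrow> frag_extend f (g y) - frag_of y \<in> frag.span S"
  shows "presented_group A R \<cong> presented_group B S"
proof (rule presented_group_iso_if_epi)
  let ?F = "free_Abelian_group A" and ?H = "free_Abelian_group B"
  let ?c = "\<lambda>y. frag.span S #>\<^bsub>?H\<^esub> y"
  note c = epi_presented_group [OF S]
  have closed: "Poly_Mapping.keys (frag_extend f x) \<subseteq> B" if "Poly_Mapping.keys x \<subseteq> A" for x
    using f that by (rule frag_extend_closed)
  have hom_f: "frag_extend f \<in> hom ?F ?H"
    by (rule homI) (use closed in \<open>auto simp: frag_extend_add\<close>)
  then show hom: "?c \<circ> frag_extend f \<in> hom ?F (presented_group B S)"
    using c(1) by (rule hom_compose)
  show "carrier (presented_group B S) \<subseteq> (?c \<circ> frag_extend f) ` carrier ?F"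
  proof
    fix T assume "T \<in> carrier (presented_group B S)"
    then obtain y where y: "Poly_Mapping.keys y \<subseteq> B" and T: "T = ?c y"
      unfolding c(2) by auto
    let ?x = "frag_extend g y"
    have x: "Poly_Mapping.keys ?x \<subseteq> A"
      using g y by (rule frag_extend_closed)
    have "frag_extend f ?x - y \<in> frag.span S"
      using fg y by (rule frag_extend_section)
    moreover have "Poly_Mapping.keys (frag_extend f ?x - y) \<subseteq> B"
      using keys_diff [of "frag_extend f ?x" y] closed [OF x] y by blast
    ultimately have "?c (frag_extend f ?x - y + y) = \<one>\<^bsub>presented_group B S\<^esub> \<otimes>\<^bsub>presented_group B S\<^esub> ?c y"
      using hom_mult [OF c(1), of "frag_extend f ?x - y" y] c(3) [of "frag_extend f ?x - y"] y by simp
    also have "\<dots> = ?c y"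
      using y group.is_monoid [OF group_presented_group [OF S]]
      by (intro monoid.l_one) (auto simp: c(2))
    finally have "?c (frag_extend f ?x) = ?c y"
      by simp
    then show "T \<in> (?c \<circ> frag_extend f) ` carrier ?F"
      using x T by (intro image_eqI [of _ _ ?x]) auto
  qed
  fix x :: "'a \<Rightarrow>\<^sub>0 int" assume x: "Poly_Mapping.keys x \<subseteq> A"
  have "x \<in> frag.span R" if "frag_extend f x \<in> frag.span S"
  proof -
    have "frag_extend g (frag_extend f x) \<in> frag.span R"
      using gS that by (rule frag_extend_span)
    moreover have "frag_extend g (frag_extend f x) - x \<in> frag.span R"
      using gf x by (rule frag_extend_section)
    ultimately show ?thesis
      by (metis add_diff_cancel_left' diff_add_cancel frag.span_diff)
  qed
  moreover have "frag_extend f x \<in> frag.span S" if "x \<in> frag.span R"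
    using fR that by (rule frag_extend_span)
  ultimately show "(?c \<circ> frag_extend f) x = \<one>\<^bsub>presented_group B S\<^esub> \<longleftrightarrow> x \<in> frag.span R"
    using c(3) [OF closed [OF x]] by auto
qed (use R S in auto)

section \<open>Direct sums of cyclic groups\<close>

lemma DirProd_assoc_iso: "(G \<times>\<times> H) \<times>\<times> K \<cong> G \<times>\<times> (H \<times>\<times> K)"
proof -
  have "(\<lambda>((x, y), z). (x, (y, z))) \<in> iso ((G \<times>\<times> H) \<times>\<times> K) (G \<times>\<times> (H \<times>\<times> K))"
    by (auto simp: iso_def hom_def inj_on_def bij_betw_def image_iff)
  then show ?thesis
    by (rule is_isoI)
qed

lemma DirProd_trivial_iso:
  assumes "group G" "trivial_group H"
  shows "H \<times>\<times> G \<cong> G"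
proof -
  have "snd \<in> iso (H \<times>\<times> G) G"
    using assms unfolding trivial_group_def
    by (intro isoI homI) (auto simp: mult_DirProd' bij_betw_def inj_on_def image_iff)
  then show ?thesis
    by (rule is_isoI)
qed

lemma trivial_groups_iso:
  assumes "trivial_group G" "trivial_group H"
  shows "G \<cong> H"
proof -
  have "(\<lambda>_. \<one>\<^bsub>H\<^esub>) \<in> iso G H"
    using assms unfolding trivial_group_def
    by (intro isoI homI) (auto simp: bij_betw_def group.is_monoid)
  then show ?thesis
    by (rule is_isoI)
qed

lemma sum_group_insert:
  fixes G :: "'i \<Rightarrow> 'b monoid"
  assumes "a \<notin> I" and G: "\<And>i. i \<in> insert a I \<Longrightarrow> group (G i)"
  shows "sum_group (insert a I) G \<cong> G a \<times>\<times> sum_group I G"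
proof -
  let ?f = "\<lambda>x. (x a, restrict x I)" and ?g = "\<lambda>(u, y). y(a := u)"
  let ?S = "sum_group (insert a I) G" and ?T = "G a \<times>\<times> sum_group I G"
  have finite: "finite {i \<in> insert a I. P i} \<longleftrightarrow> finite {i \<in> I. P i}" for P
  proof -
    have "{i \<in> insert a I. P i} = {i \<in> I. P i} \<union> (if P a then {a} else {})"
      by auto
    then show ?thesis
      by simp
  qed
  have carrier_S: "carrier ?S = {x \<in> \<Pi>\<^sub>E i\<in>insert a I. carrier (G i). finite {i \<in> I. x i \<noteq> \<one>\<^bsub>G i\<^esub>}}"
    and carrier_T: "carrier ?T = carrier (G a) \<times> {x \<in> \<Pi>\<^sub>E i\<in>I. carrier (G i). finite {i \<in> I. x i \<noteq> \<one>\<^bsub>G i\<^esub>}}"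
    using G carrier_sum_group [of "insert a I" G] carrier_sum_group [of I G]
    by (simp_all add: finite del: insert_iff) simp
  have cong: "{i \<in> I. restrict x I i \<noteq> \<one>\<^bsub>G i\<^esub>} = {i \<in> I. x i \<noteq> \<one>\<^bsub>G i\<^esub>}"
    "{i \<in> I. (x(a := u)) i \<noteq> \<one>\<^bsub>G i\<^esub>} = {i \<in> I. x i \<noteq> \<one>\<^bsub>G i\<^esub>}" for x u
    using assms(1) by auto
  have f: "?f x \<in> carrier ?T" if "x \<in> carrier ?S" for x
    using that unfolding carrier_S carrier_T by (auto simp: cong simp del: restrict_apply)
  have g: "?g y \<in> carrier ?S" if "y \<in> carrier ?T" for y
    using that assms(1) unfolding carrier_S carrier_T
    by (auto simp: cong PiE_iff extensional_def simp del: fun_upd_apply) auto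
  have "bij_betw ?f (carrier ?S) (carrier ?T)"
  proof (rule bij_betw_byWitness [where f' = ?g])
    show "\<forall>x\<in>carrier ?S. ?g (?f x) = x"
      unfolding carrier_S by (auto simp: fun_eq_iff PiE_iff extensional_def)
    show "\<forall>y\<in>carrier ?T. ?f (?g y) = y"
      using assms(1) unfolding carrier_T by (auto simp: fun_eq_iff PiE_iff extensional_def)
  qed (use f g in blast)+
  moreover have "?f \<in> hom ?S ?T"
    by (rule homI [OF f]) (auto simp: fun_eq_iff)
  ultimately show ?thesis
    by (auto simp: iso_def intro: is_isoI)
qed

text \<open>The direct sum of the groups \<open>\<int>/d\<close>, with \<open>d\<close> ranging over a multiset; \<open>d = 0\<close> stands for \<open>\<int>\<close>.
  Indexing by \<open>(d, i)\<close>, where \<open>i\<close> numbers the occurrences of \<open>d\<close>, makes the group a function of the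
  multiset. Two decompositions with the same orders are then isomorphic without any reindexing, and
  adding an occurrence of \<open>d\<close> adds the single index \<open>(d, count M d)\<close>.\<close>

definition cyclic_sum :: "nat multiset \<Rightarrow> (nat \<times> nat \<Rightarrow> int) monoid" where
  "cyclic_sum M = sum_group {(d, i). i < count M d} (\<lambda>(d, i). integer_mod_group d)"

lemma group_cyclic_sum [simp]: "group (cyclic_sum M)"
  unfolding cyclic_sum_def by (intro sum_group) auto

lemma cyclic_sum_add_mset: "cyclic_sum (add_mset d M) \<cong> integer_mod_group d \<times>\<times> cyclic_sum M"
proof -
  have "{(e, i). i < count (add_mset d M) e} = insert (d, count M d) {(e, i). i < count M e}"
    by (auto split: if_splits)
  then show ?thesis
    using sum_group_insert [of "(d, count M d)" "{(e, i). i < count M e}" "\<lambda>(e, i). integer_mod_group e"]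
    by (simp add: cyclic_sum_def split_beta)
qed

lemma trivial_sum_group_empty: "trivial_group (sum_group {} G)"
  unfolding trivial_group_def
proof
  show "group (sum_group {} G)"
    by (rule sum_group) simp
  show "carrier (sum_group {} G) = {\<one>\<^bsub>sum_group {} G\<^esub>}"
    by (subst carrier_sum_group) auto
qed

lemma cyclic_sum_empty: "trivial_group (cyclic_sum {#})"
  by (simp add: cyclic_sum_def trivial_sum_group_empty)

lemma cyclic_sum_single: "integer_mod_group d \<cong> cyclic_sum {#d#}"
proof -
  have "integer_mod_group d \<times>\<times> cyclic_sum {#} \<cong> cyclic_sum {#} \<times>\<times> integer_mod_group d"
    by (rule DirProd_commute_iso)
  also have "\<dots> \<cong> integer_mod_group d"
    by (simp add: DirProd_trivial_iso cyclic_sum_empty)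
  finally have "cyclic_sum {#d#} \<cong> integer_mod_group d"
    using cyclic_sum_add_mset iso_trans by blast
  then show ?thesis
    by (rule group.iso_sym [OF group_cyclic_sum])
qed

lemma cyclic_sum_plus: "cyclic_sum M \<times>\<times> cyclic_sum N \<cong> cyclic_sum (M + N)"
proof (induction M)
  case empty
  then show ?case
    by (simp add: DirProd_trivial_iso cyclic_sum_empty)
next
  case (add d M)
  let ?Z = "integer_mod_group d"
  have "cyclic_sum (add_mset d M) \<times>\<times> cyclic_sum N \<cong> (?Z \<times>\<times> cyclic_sum M) \<times>\<times> cyclic_sum N"
    by (intro group.DirProd_iso_trans cyclic_sum_add_mset iso_refl) simp
  also have "\<dots> \<cong> ?Z \<times>\<times> (cyclic_sum M \<times>\<times> cyclic_sum N)"
    by (rule DirProd_assoc_iso)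
  also have "\<dots> \<cong> ?Z \<times>\<times> cyclic_sum (M + N)"
    by (intro group.DirProd_iso_trans add iso_refl) simp
  also have "\<dots> \<cong> cyclic_sum (add_mset d M + N)"
    using group.iso_sym [OF group_cyclic_sum cyclic_sum_add_mset] by simp
  finally show ?case .
qed

lemma DirProd_iso_cyclic_sum:
  assumes "group G" "G \<cong> cyclic_sum M" "H \<cong> cyclic_sum N"
  shows "G \<times>\<times> H \<cong> cyclic_sum (M + N)"
  using group.DirProd_iso_trans [OF assms] cyclic_sum_plus by (rule iso_trans)

lemma sum_group_iso_cyclic_sum:
  fixes G :: "'i \<Rightarrow> 'b monoid"
  assumes "finite I" and "\<And>i. i \<in> I \<Longrightarrow> group (G i)" and "\<And>i. i \<in> I \<Longrightarrow> G i \<cong> cyclic_sum (M i)"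
  shows "sum_group I G \<cong> cyclic_sum (\<Sum>i\<in>I. M i)"
  using assms
proof (induction I rule: finite_induct)
  case empty
  then show ?case
    by (simp add: trivial_groups_iso trivial_sum_group_empty cyclic_sum_empty)
next
  case (insert a I)
  have "sum_group (insert a I) G \<cong> G a \<times>\<times> sum_group I G"
    using insert by (intro sum_group_insert) auto
  also have "\<dots> \<cong> cyclic_sum (M a + (\<Sum>i\<in>I. M i))"
    using insert by (intro DirProd_iso_cyclic_sum) auto
  finally show ?case
    using insert by simp
qed

lemma sum_group_const_iso_cyclic_sum:
  assumes "finite I"
  shows "sum_group I (\<lambda>_. integer_mod_group d) \<cong> cyclic_sum (replicate_mset (card I) d)"
proof -
  have "sum_group I (\<lambda>_. integer_mod_group d) \<cong> cyclic_sum (\<Sum>i\<in>I. {#d#})"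
    by (intro sum_group_iso_cyclic_sum assms cyclic_sum_single) auto
  moreover have "(\<Sum>i\<in>I. {#d#}) = replicate_mset (card I) d"
    using assms by (induction I rule: finite_induct) auto
  ultimately show ?thesis
    by simp
qed

lemma cyclic_sum_drop_ones: "cyclic_sum (replicate_mset k 1 + M) \<cong> cyclic_sum M"
proof (induction k)
  case (Suc k)
  have "cyclic_sum (replicate_mset (Suc k) 1 + M) \<cong>
      integer_mod_group 1 \<times>\<times> cyclic_sum (replicate_mset k 1 + M)"
    using cyclic_sum_add_mset [of 1 "replicate_mset k 1 + M"] by simp
  also have "\<dots> \<cong> cyclic_sum (replicate_mset k 1 + M)"
    by (intro DirProd_trivial_iso) (simp_all add: trivial_integer_mod_group)
  finally show ?case
    using Suc iso_trans by blast
qed (simp add: iso_refl)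

section \<open>Presentations of direct products\<close>

text \<open>The coordinates of an element, reduced modulo the respective \<open>d a\<close>, all vanish exactly if the element
  is an integer combination of the relators.\<close>

lemma presented_group_cyclic:
  "presented_group A ((\<lambda>a. frag_cmul (int (d a)) (frag_of a)) ` A) \<cong>
   sum_group A (\<lambda>a. integer_mod_group (d a))"
proof (rule presented_group_iso_if_epi)
  let ?T = "sum_group A (\<lambda>a. integer_mod_group (d a))"
  let ?R = "(\<lambda>a. frag_cmul (int (d a)) (frag_of a)) ` A"
  let ?\<phi> = "\<lambda>x. \<lambda>a\<in>A. Poly_Mapping.lookup x a mod int (d a)"
  have T: "carrier ?T = {y \<in> \<Pi>\<^sub>E a\<in>A. carrier (integer_mod_group (d a)). finite {a \<in> A. y a \<noteq> 0}}"
    by (simp add: carrier_sum_group)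
  show "?\<phi> \<in> hom (free_Abelian_group A) ?T"
  proof (rule homI)
    fix x :: "'a \<Rightarrow>\<^sub>0 int" assume "x \<in> carrier (free_Abelian_group A)"
    have "finite {a \<in> A. ?\<phi> x a \<noteq> 0}"
      by (rule finite_subset [OF _ finite_keys [of x]]) (auto simp: in_keys_iff)
    then show "?\<phi> x \<in> carrier ?T"
      unfolding T by (auto simp: carrier_integer_mod_group)
  qed (simp add: lookup_add mod_add_eq fun_eq_iff)
  show "carrier ?T \<subseteq> ?\<phi> ` carrier (free_Abelian_group A)"
  proof
    fix y assume y: "y \<in> carrier ?T"
    let ?x = "Abs_poly_mapping (\<lambda>a. if a \<in> A then y a else 0)"
    have "{a. (if a \<in> A then y a else 0) \<noteq> 0} = {a \<in> A. y a \<noteq> 0}"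
      by auto
    then have x: "Poly_Mapping.lookup ?x = (\<lambda>a. if a \<in> A then y a else 0)"
      using y by (simp add: T)
    show "y \<in> ?\<phi> ` carrier (free_Abelian_group A)"
    proof (rule image_eqI)
      show "y = ?\<phi> ?x"
        using y unfolding x T 
        by (fastforce simp: fun_eq_iff PiE_iff extensional_def carrier_integer_mod_group split: if_splits)
      show "?x \<in> carrier (free_Abelian_group A)"
        unfolding carrier_free_Abelian_group_iff
        by (auto simp: in_keys_iff x split: if_splits simp del: lookup_Abs_poly_mapping)
    qed
  qed
  show "?\<phi> x = \<one>\<^bsub>?T\<^esub> \<longleftrightarrow> x \<in> frag.span ?R" if x: "Poly_Mapping.keys x \<subseteq> A" for x
  proof
    assume "?\<phi> x = \<one>\<^bsub>?T\<^esub>"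
    then have dvd: "int (d a) dvd Poly_Mapping.lookup x a" if "a \<in> A" for a
      using that by (auto simp: fun_eq_iff dvd_eq_mod_eq_0 dest: spec [of _ a])
    have "x = (\<Sum>a\<in>Poly_Mapping.keys x. frag_cmul (Poly_Mapping.lookup x a) (frag_of a))"
      unfolding frag_extend_def [symmetric] by (rule frag_expansion)
    also have "\<dots> \<in> frag.span ?R"
    proof (rule frag.span_sum)
      fix a assume "a \<in> Poly_Mapping.keys x"
      with x have a: "a \<in> A"
        by blast
      then obtain c where c: "Poly_Mapping.lookup x a = int (d a) * c"
        using dvd by blast
      have "frag_cmul c (frag_cmul (int (d a)) (frag_of a)) \<in> frag.span ?R"
        using a by (intro frag.span_scale frag.span_base) auto
      then show "frag_cmul (Poly_Mapping.lookup x a) (frag_of a) \<in> frag.span ?R"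
        by (simp add: c mult.commute)
    qed
    finally show "x \<in> frag.span ?R" .
  next
    assume "x \<in> frag.span ?R"
    then have "\<forall>a. int (d a) dvd Poly_Mapping.lookup x a"
      by (induction rule: frag.span_induct_alt) (auto simp: lookup_add intro!: dvd_add)
    then show "?\<phi> x = \<one>\<^bsub>?T\<^esub>"
      by (auto simp: fun_eq_iff)
  qed
qed auto

text \<open>The presentation of a direct product is the disjoint union of presentations.\<close>

lemma presented_group_Plus:
  assumes R: "R \<subseteq> carrier (free_Abelian_group A)" and S: "S \<subseteq> carrier (free_Abelian_group B)"
  shows "presented_group (A <+> B)
      (frag_extend (frag_of \<circ> Inl) ` R \<union> frag_extend (frag_of \<circ> Inr) ` S) \<cong>
    presented_group A R \<times>\<times> presented_group B S"
proof (rule presented_group_iso_if_epi)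
  let ?l = "frag_extend (case_sum frag_of (\<lambda>_. 0)) :: ('a + 'b \<Rightarrow>\<^sub>0 int) \<Rightarrow> 'a \<Rightarrow>\<^sub>0 int"
  let ?r = "frag_extend (case_sum (\<lambda>_. 0) frag_of) :: ('a + 'b \<Rightarrow>\<^sub>0 int) \<Rightarrow> 'b \<Rightarrow>\<^sub>0 int"
  let ?il = "frag_extend (frag_of \<circ> Inl) :: ('a \<Rightarrow>\<^sub>0 int) \<Rightarrow> 'a + 'b \<Rightarrow>\<^sub>0 int"
  let ?ir = "frag_extend (frag_of \<circ> Inr) :: ('b \<Rightarrow>\<^sub>0 int) \<Rightarrow> 'a + 'b \<Rightarrow>\<^sub>0 int"
  let ?c = "\<lambda>x. frag.span R #>\<^bsub>free_Abelian_group A\<^esub> x"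
  let ?e = "\<lambda>x. frag.span S #>\<^bsub>free_Abelian_group B\<^esub> x"
  let ?U = "?il ` R \<union> ?ir ` S"
  note c = epi_presented_group [OF R] and e = epi_presented_group [OF S]
  have l_closed: "Poly_Mapping.keys (?l x) \<subseteq> A" and r_closed: "Poly_Mapping.keys (?r x) \<subseteq> B"
    if "Poly_Mapping.keys x \<subseteq> A <+> B" for x
    by (rule frag_extend_closed [OF _ that]; auto)+
  have il_closed: "Poly_Mapping.keys (?il x) \<subseteq> A <+> B" if "Poly_Mapping.keys x \<subseteq> A" for x
    using that by (rule frag_extend_closed [rotated]) auto
  have ir_closed: "Poly_Mapping.keys (?ir x) \<subseteq> A <+> B" if "Poly_Mapping.keys x \<subseteq> B" for x
    using that by (rule frag_extend_closed [rotated]) auto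
  have inv: "?l (?il x) = x" "?r (?il x) = 0" "?r (?ir y) = y" "?l (?ir y) = 0" for x y
    by (simp_all add: frag_extend_compose) (simp_all add: comp_def frag_extend_eq_0 flip: frag_expansion)
  have decomp: "?il (?l x) + ?ir (?r x) = x" for x
    using subset_UNIV [of "Poly_Mapping.keys x"]
  proof (induction rule: frag_induction)
    case (one x)
    then show ?case
      by (cases x) auto
  qed (auto simp: frag_extend_diff algebra_simps)
  have hom_l: "?l \<in> hom (free_Abelian_group (A <+> B)) (free_Abelian_group A)"
    and hom_r: "?r \<in> hom (free_Abelian_group (A <+> B)) (free_Abelian_group B)"
    using l_closed r_closed by (auto simp: hom_def frag_extend_add)
  show "(\<lambda>x. ((?c \<circ> ?l) x, (?e \<circ> ?r) x)) \<in>
      hom (free_Abelian_group (A <+> B)) (presented_group A R \<times>\<times> presented_group B S)"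
    unfolding hom_paired by (intro conjI hom_compose [OF hom_l c(1)] hom_compose [OF hom_r e(1)])
  show "carrier (presented_group A R \<times>\<times> presented_group B S) \<subseteq>
      (\<lambda>x. ((?c \<circ> ?l) x, (?e \<circ> ?r) x)) ` carrier (free_Abelian_group (A <+> B))"
  proof
    fix p assume "p \<in> carrier (presented_group A R \<times>\<times> presented_group B S)"
    then obtain x y where xy: "Poly_Mapping.keys x \<subseteq> A" "Poly_Mapping.keys y \<subseteq> B" "p = (?c x, ?e y)"
      by (auto simp: c(2) e(2))
    show "p \<in> (\<lambda>x. ((?c \<circ> ?l) x, (?e \<circ> ?r) x)) ` carrier (free_Abelian_group (A <+> B))"
      using xy il_closed [OF xy(1)] ir_closed [OF xy(2)] keys_add [of "?il x" "?ir y"]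
      by (intro image_eqI [of _ _ "?il x + ?ir y"]) (auto simp: frag_extend_add inv)
  qed
  show "((?c \<circ> ?l) x, (?e \<circ> ?r) x) = \<one>\<^bsub>presented_group A R \<times>\<times> presented_group B S\<^esub> \<longleftrightarrow> x \<in> frag.span ?U"
    if x: "Poly_Mapping.keys x \<subseteq> A <+> B" for x
  proof -
    have "x \<in> frag.span ?U" if "?l x \<in> frag.span R" "?r x \<in> frag.span S"
    proof -
      have "?il (?l x) \<in> frag.span ?U"
        by (rule frag_extend_span [OF _ that(1)]) (auto intro: frag.span_base)
      moreover have "?ir (?r x) \<in> frag.span ?U"
        by (rule frag_extend_span [OF _ that(2)]) (auto intro: frag.span_base)
      ultimately show ?thesis
        using decomp [of x] frag.span_add by metis
    qed
    moreover have "?l x \<in> frag.span R" "?r x \<in> frag.span S" if "x \<in> frag.span ?U"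
      using that by (auto intro!: frag_extend_span [OF _ that] simp: inv intro: frag.span_base frag.span_zero)
    ultimately show ?thesis
      using c(3) [OF l_closed [OF x]] e(3) [OF r_closed [OF x]] by auto
  qed
  show "?U \<subseteq> carrier (free_Abelian_group (A <+> B))"
    using R S il_closed ir_closed by (auto simp: subset_iff)
qed (use R S in \<open>auto intro: DirProd_group\<close>)

section \<open>Line graphs of digraphs with all degrees two\<close>

text \<open>\<open>Inr v\<close> is the vertex \<open>v\<close> as a generator of the cokernel of the Laplacian, and \<open>Inl v\<close> is an adjoined
  element that yields \<open>c v\<close> when multiplied by \<open>2 ^ k\<close>. Both out-neighbours \<open>c v\<close> and \<open>c' v\<close> enter
  the Laplacian, but only \<open>c v\<close> is divided.\<close>

definition divided_relators :: "'v set \<Rightarrow> ('v \<Rightarrow> 'v) \<Rightarrow> ('v \<Rightarrow> 'v) \<Rightarrow> nat \<Rightarrow> ('v + 'v \<Rightarrow>\<^sub>0 int) set" where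
  "divided_relators V c c' k =
     (\<lambda>v. frag_cmul 2 (frag_of (Inr v)) - frag_of (Inr (c v)) - frag_of (Inr (c' v))) ` V \<union>
     (\<lambda>v. frag_cmul (2 ^ k) (frag_of (Inl v)) - frag_of (Inr (c v))) ` V"

definition divided_group :: "'v set \<Rightarrow> ('v \<Rightarrow> 'v) \<Rightarrow> ('v \<Rightarrow> 'v) \<Rightarrow> nat \<Rightarrow> ('v + 'v \<Rightarrow>\<^sub>0 int) set monoid" where
  "divided_group V c c' k = presented_group (V <+> V) (divided_relators V c c' k)"

lemmas keys_dests = keys_diff [THEN subsetD] keys_add [THEN subsetD]

lemma divided_relators_closed:
  assumes "c ` V \<subseteq> V" "c' ` V \<subseteq> V"
  shows "divided_relators V c c' k \<subseteq> carrier (free_Abelian_group (V <+> V))"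
  using assms unfolding divided_relators_def
  by (auto simp: image_subset_iff dest!: keys_dests)

lemma group_divided_group [simp]:
  "c ` V \<subseteq> V \<Longrightarrow> c' ` V \<subseteq> V \<Longrightarrow> group (divided_group V c c' k)"
  unfolding divided_group_def by (intro group_presented_group divided_relators_closed)

lemmas frag_extend_simps = frag_extend_add frag_extend_diff frag_extend_cmul
lemmas frag_scale_simps = frag.scale_right_distrib frag.scale_right_diff_distrib

lemma frag_cmul_2: "frag_cmul 2 x = x + x"
  using frag_cmul_distrib [of 1 1 x] by simp

text \<open>A digraph with two arcs \<open>p v\<close>, \<open>q v\<close> out of every vertex and two arcs \<open>i v\<close>, \<open>j v\<close> into it. The order
  within the two pairs is a choice: \<open>p\<close> marks the out-neighbours to be divided, and \<open>i\<close> marks the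
  arcs whose adjoined elements survive the elimination in the line graph.\<close>

locale two_regular =
  fixes V :: "'v set" and E :: "'e set" and tl hd :: "'e \<Rightarrow> 'v" and p q i j :: "'v \<Rightarrow> 'e"
  assumes finite_V: "finite V"
    and out_arcs: "v \<in> V \<Longrightarrow> {e \<in> E. tl e = v} = {p v, q v}" and p_neq_q: "v \<in> V \<Longrightarrow> p v \<noteq> q v"
    and in_arcs: "v \<in> V \<Longrightarrow> {e \<in> E. hd e = v} = {i v, j v}" and i_neq_j: "v \<in> V \<Longrightarrow> i v \<noteq> j v"
    and tl_closed: "e \<in> E \<Longrightarrow> tl e \<in> V" and hd_closed: "e \<in> E \<Longrightarrow> hd e \<in> V"
begin

lemma out_simps [simp]:
  assumes "v \<in> V"
  shows "p v \<in> E" "q v \<in> E" "tl (p v) = v" "tl (q v) = v" "p v \<noteq> q v" "q v \<noteq> p v"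
  using out_arcs [OF assms] p_neq_q [OF assms] by auto

lemma in_simps [simp]:
  assumes "v \<in> V"
  shows "i v \<in> E" "j v \<in> E" "hd (i v) = v" "hd (j v) = v" "i v \<noteq> j v" "j v \<noteq> i v"
  using in_arcs [OF assms] i_neq_j [OF assms] by auto

lemma out_cases:
  assumes "e \<in> E"
  obtains (p) v where "v \<in> V" "e = p v" | (q) v where "v \<in> V" "e = q v"
  using assms out_arcs [OF tl_closed [OF assms]] tl_closed by blast

lemma in_cases:
  assumes "e \<in> E"
  obtains (i) v where "v \<in> V" "e = i v" | (j) v where "v \<in> V" "e = j v"
  using assms in_arcs [OF hd_closed [OF assms]] hd_closed by blast

text \<open>The elimination step. In the notation of the proof, the line graph has generators \<open>?b e\<close> (adjoined) and
  \<open>?h e\<close> (vertices of the line graph), while \<open>V\<close> has \<open>?a v\<close>, \<open>?g v\<close> and one generator \<open>?z v\<close> of order \<open>2 ^ k\<close>. The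
  correspondence is \<open>?a v = ?b (i v)\<close>, \<open>?z v = ?b (j v) - ?b (i v)\<close> and \<open>?g v = ?h (p v) + ?h (q v)\<close>;
  the relation \<open>2 ^ k * ?b (i v) = ?h (p v)\<close> then determines \<open>?h (p v)\<close> and \<open>?h (q v)\<close>.\<close>

lemma divided_group_line_iso:
  "divided_group E (p \<circ> hd) (q \<circ> hd) k \<cong>
   divided_group V (hd \<circ> p) (hd \<circ> q) (Suc k) \<times>\<times> sum_group V (\<lambda>_. integer_mod_group (2 ^ k))"
proof -
  let ?R = "divided_relators E (p \<circ> hd) (q \<circ> hd) k"
  let ?S = "divided_relators V (hd \<circ> p) (hd \<circ> q) (Suc k)"
  let ?Z = "(\<lambda>v. frag_cmul (int (2 ^ k)) (frag_of v)) ` V"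
  define T where "T = frag_extend (frag_of \<circ> Inl) ` ?S \<union> frag_extend (frag_of \<circ> Inr) ` ?Z"
  let ?a = "\<lambda>v. frag_of (Inl (Inl v)) :: ('v + 'v) + 'v \<Rightarrow>\<^sub>0 int"
  let ?g = "\<lambda>v. frag_of (Inl (Inr v)) :: ('v + 'v) + 'v \<Rightarrow>\<^sub>0 int"
  let ?z = "\<lambda>v. frag_of (Inr v) :: ('v + 'v) + 'v \<Rightarrow>\<^sub>0 int"
  let ?b = "\<lambda>e. frag_of (Inl e) :: 'e + 'e \<Rightarrow>\<^sub>0 int"
  let ?h = "\<lambda>e. frag_of (Inr e) :: 'e + 'e \<Rightarrow>\<^sub>0 int"
  define f where "f = case_sum
      (\<lambda>e. if e = j (hd e) then ?a (hd e) + ?z (hd e) else ?a (hd e))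
      (\<lambda>e. if e = q (tl e) then ?g (tl e) - frag_cmul (2 ^ k) (?a (tl e)) else frag_cmul (2 ^ k) (?a (tl e)))"
  define f' where "f' = case_sum
      (case_sum (\<lambda>v. ?b (i v)) (\<lambda>v. ?h (p v) + ?h (q v))) (\<lambda>v. ?b (j v) - ?b (i v))"
  have f: "f (Inl (i v)) = ?a v" "f (Inl (j v)) = ?a v + ?z v"
    "f (Inr (p v)) = frag_cmul (2 ^ k) (?a v)" "f (Inr (q v)) = ?g v - frag_cmul (2 ^ k) (?a v)"
    if "v \<in> V" for v
    using that by (simp_all add: f_def)
  have f': "f' (Inl (Inl v)) = ?b (i v)" "f' (Inl (Inr v)) = ?h (p v) + ?h (q v)"
    "f' (Inr v) = ?b (j v) - ?b (i v)" for v
    by (simp_all add: f'_def)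
  have S: "?S \<subseteq> carrier (free_Abelian_group (V <+> V))"
    by (intro divided_relators_closed) (auto simp: hd_closed)
  have T: "T \<subseteq> carrier (free_Abelian_group ((V <+> V) <+> V))"
  proof -
    have "Poly_Mapping.keys (frag_extend (frag_of \<circ> Inl) s) \<subseteq> (V <+> V) <+> V" if "s \<in> ?S" for s
      using subsetD [OF S that] by (intro frag_extend_closed [where A = "V <+> V"]) auto
    moreover have "Poly_Mapping.keys (frag_extend (frag_of \<circ> Inr) s) \<subseteq> (V <+> V) <+> V" if "s \<in> ?Z" for s
      using that by (intro frag_extend_closed [where A = V]) auto
    ultimately show ?thesis
      unfolding T_def by (auto simp del: keys_single)
  qed
  have R: "?R \<subseteq> carrier (free_Abelian_group (E <+> E))"
    by (intro divided_relators_closed) (auto simp: hd_closed)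
  have T_g: "frag_cmul 2 (?g v) - ?g (hd (p v)) - ?g (hd (q v)) \<in> frag.span T" if "v \<in> V" for v
  proof (unfold T_def, rule frag.span_base, rule UnI1, rule image_eqI)
    show "frag_cmul 2 (frag_of (Inr v)) - frag_of (Inr (hd (p v))) - frag_of (Inr (hd (q v))) \<in> ?S"
      using that by (auto simp: divided_relators_def)
  qed (simp add: frag_extend_simps)
  have T_a: "frag_cmul (2 ^ Suc k) (?a v) - ?g (hd (p v)) \<in> frag.span T" if "v \<in> V" for v
  proof (unfold T_def, rule frag.span_base, rule UnI1, rule image_eqI)
    show "frag_cmul (2 ^ Suc k) (frag_of (Inl v)) - frag_of (Inr (hd (p v))) \<in> ?S"
      using that by (auto simp: divided_relators_def)
  qed (simp add: frag_extend_simps)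
  have T_z: "frag_cmul (2 ^ k) (?z v) \<in> frag.span T" if "v \<in> V" for v
  proof (unfold T_def, rule frag.span_base, rule UnI2, rule image_eqI)
    show "frag_cmul (int (2 ^ k)) (frag_of v) \<in> ?Z"
      using that by blast
  qed (simp add: frag_extend_simps)
  have R_g: "frag_cmul 2 (?h e) - ?h (p (hd e)) - ?h (q (hd e)) \<in> frag.span ?R" if "e \<in> E" for e
    using that by (intro frag.span_base) (auto simp: divided_relators_def)
  have R_a: "frag_cmul (2 ^ k) (?b e) - ?h (p (hd e)) \<in> frag.span ?R" if "e \<in> E" for e
    using that by (intro frag.span_base) (auto simp: divided_relators_def)
  have "presented_group (E <+> E) ?R \<cong> presented_group ((V <+> V) <+> V) T"
  proof (rule presented_group_isoI [OF R T])
    fix x assume x: "x \<in> E <+> E"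
    show "Poly_Mapping.keys (f x) \<subseteq> (V <+> V) <+> V"
      using x tl_closed hd_closed unfolding f_def
      by (auto dest!: keys_dests split: if_splits)
    show "frag_extend f' (f x) - frag_of x \<in> frag.span ?R"
    proof (cases x)
      case (Inl e)
      then have "e \<in> E"
        using x by auto
      then show ?thesis
        by (cases rule: in_cases) (auto simp: Inl f f' frag_extend_simps frag.span_zero)
    next
      case (Inr e)
      then have "e \<in> E"
        using x by auto
      then show ?thesis
      proof (cases rule: out_cases)
        case (p v)
        then show ?thesis
          using R_a [of "i v"] by (simp add: Inr f f' frag_extend_simps)
      next
        case (q v)
        then show ?thesis
          using frag.span_neg [OF R_a [of "i v"]] by (simp add: Inr f f' frag_extend_simps)
      qed
    qed
  next
    fix y assume y: "y \<in> (V <+> V) <+> V"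
    show "Poly_Mapping.keys (f' y) \<subseteq> E <+> E"
      using y unfolding f'_def
      by (auto dest!: keys_dests split: if_splits)
    show "frag_extend f (f' y) - frag_of y \<in> frag.span T"
      using y by (auto simp: f f' frag_extend_simps frag.span_zero)
  next
    fix r assume "r \<in> ?R"
    then consider (g) e where "e \<in> E" "r = frag_cmul 2 (?h e) - ?h (p (hd e)) - ?h (q (hd e))"
      | (a) e where "e \<in> E" "r = frag_cmul (2 ^ k) (?b e) - ?h (p (hd e))"
      unfolding divided_relators_def by auto
    then show "frag_extend f r \<in> frag.span T"
    proof cases
      case g
      have r: "frag_extend f r = frag_cmul 2 (f (Inr e)) - ?g (hd e)"
        using g hd_closed by (simp add: f frag_extend_simps)
      from \<open>e \<in> E\<close> show ?thesis
      proof (cases rule: out_cases)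
        case (p v)
        then show ?thesis
          \<comment> \<open>here the Laplacian relator at \<open>p v\<close> becomes the relator that divides \<open>hd (p v)\<close> by \<open>2 ^ Suc k\<close>\<close>
          using T_a [of v] by (simp add: r f)
      next
        case (q v)
        then have "frag_extend f r = (frag_cmul 2 (?g v) - ?g (hd (p v)) - ?g (hd (q v)))
            - (frag_cmul (2 ^ Suc k) (?a v) - ?g (hd (p v)))"
          by (simp add: r f frag_scale_simps)
        then show ?thesis
          using frag.span_diff [OF T_g T_a] q by (simp only:)
      qed
    next
      case a
      from \<open>e \<in> E\<close> show ?thesis
        by (cases rule: in_cases) (auto simp: a f frag_extend_simps frag_scale_simps frag.span_zero T_z)
    qed
  next
    fix s assume "s \<in> T"
    then consider (g) v where "v \<in> V" "s = frag_cmul 2 (?g v) - ?g (hd (p v)) - ?g (hd (q v))"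
      | (a) v where "v \<in> V" "s = frag_cmul (2 ^ Suc k) (?a v) - ?g (hd (p v))"
      | (z) v where "v \<in> V" "s = frag_cmul (2 ^ k) (?z v)"
      unfolding T_def divided_relators_def by (auto simp: frag_extend_simps)
    then show "frag_extend f' s \<in> frag.span ?R"
    proof cases
      case g
      then have "frag_extend f' s = (frag_cmul 2 (?h (p v)) - ?h (p (hd (p v))) - ?h (q (hd (p v))))
          + (frag_cmul 2 (?h (q v)) - ?h (p (hd (q v))) - ?h (q (hd (q v))))"
        by (simp add: f' frag_extend_simps frag_scale_simps)
      then show ?thesis
        using frag.span_add [OF R_g R_g] g by simp
    next
      case a
      then have "frag_extend f' s = frag_cmul 2 (frag_cmul (2 ^ k) (?b (i v)) - ?h (p v))
          + (frag_cmul 2 (?h (p v)) - ?h (p (hd (p v))) - ?h (q (hd (p v))))"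
        by (simp add: f' frag_extend_simps frag_scale_simps)
      then show ?thesis
        using frag.span_add [OF frag.span_scale [OF R_a [of "i v"]] R_g [of "p v"]] a by simp
    next
      case z
      then have "frag_extend f' s = (frag_cmul (2 ^ k) (?b (j v)) - ?h (p v)) - (frag_cmul (2 ^ k) (?b (i v)) - ?h (p v))"
        by (simp add: f' frag_extend_simps frag_scale_simps)
      then show ?thesis
        using frag.span_diff [OF R_a [of "j v"] R_a [of "i v"]] z by simp
    qed
  qed
  also have "\<dots> \<cong> presented_group (V <+> V) ?S \<times>\<times> presented_group V ?Z"
    unfolding T_def by (intro presented_group_Plus S) auto
  also have "\<dots> \<cong> presented_group (V <+> V) ?S \<times>\<times> sum_group V (\<lambda>_. integer_mod_group (2 ^ k))"
    by (intro group.DirProd_iso_trans group_presented_group S iso_refl presented_group_cyclic)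
  finally show ?thesis
    unfolding divided_group_def .
qed

end

text \<open>For \<open>k = 0\<close> the adjoined elements are just names for the vertices \<open>c v\<close>.\<close>

lemma divided_group_0_iso:
  assumes c: "c ` V \<subseteq> V" "c' ` V \<subseteq> V"
  shows "presented_group V ((\<lambda>v. frag_cmul 2 (frag_of v) - frag_of (c v) - frag_of (c' v)) ` V) \<cong>
    divided_group V c c' 0"
  unfolding divided_group_def
proof (rule presented_group_isoI)
  let ?R = "(\<lambda>v. frag_cmul 2 (frag_of v) - frag_of (c v) - frag_of (c' v)) ` V"
  let ?S = "divided_relators V c c' 0"
  let ?f = "\<lambda>v. frag_of (Inr v)" and ?f' = "case_sum (\<lambda>v. frag_of (c v)) frag_of"
  show "?S \<subseteq> carrier (free_Abelian_group (V <+> V))"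
    using c by (rule divided_relators_closed)
  show "?R \<subseteq> carrier (free_Abelian_group V)"
    using c by (auto simp: image_subset_iff dest!: keys_dests)
  show "frag_extend ?f r \<in> frag.span ?S" if "r \<in> ?R" for r
    using that by (intro frag.span_base) (auto simp: divided_relators_def frag_extend_simps)
  show "frag_extend ?f' s \<in> frag.span ?R" if "s \<in> ?S" for s
    using that unfolding divided_relators_def
    by (auto simp: frag_extend_simps intro: frag.span_zero frag.span_base)
  show "frag_extend ?f (?f' y) - frag_of y \<in> frag.span ?S" if "y \<in> V <+> V" for y
  proof (cases y)
    case (Inl v)
    then have "frag_of (Inl v) - frag_of (Inr (c v)) \<in> ?S"
      using that by (auto simp: divided_relators_def)
    then show ?thesis
      using frag.span_neg [OF frag.span_base] by (fastforce simp: Inl)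
  qed (simp add: frag.span_zero)
qed (use c in \<open>auto simp: frag.span_zero\<close>)

section \<open>The triangle\<close>

text \<open>The relations \<open>2 ^ m * a v = g (c v)\<close> express every \<open>g v\<close> because \<open>c\<close> is a rotation. In the basis
  \<open>a x\<close>, \<open>u = a y + a w - 2 * a x\<close>, \<open>b = a w - a x\<close> the remaining relations are equivalent to
  \<open>2 ^ m * u = 0\<close> and \<open>3 * 2 ^ m * b = 0\<close>. By the Chinese remainder theorem \<open>b\<close> is the sum of
  \<open>s * 2 ^ m * b\<close> of order \<open>3\<close> and \<open>3 * t * b\<close> of order \<open>2 ^ m\<close>, where \<open>s * 2 ^ m + 3 * t = 1\<close>.\<close>

lemma divided_group_triangle_iso:
  assumes distinct: "x \<noteq> y" "y \<noteq> w" "w \<noteq> x"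
    and c: "c x = y" "c y = w" "c w = x" and c': "c' x = w" "c' y = x" "c' w = y"
  shows "divided_group {x, y, w} c c' m \<cong> cyclic_sum {#0, 3, 2 ^ m, 2 ^ m#}"
proof -
  let ?V = "{x, y, w}"
  define R where "R = divided_relators ?V c c' m"
  \<comment> \<open>the free generator has index 4, since \<open>frag_of 0\<close> would be rewritten to the unit of a ring\<close>
  define d :: "nat \<Rightarrow> nat" where "d = (\<lambda>_. 0)(1 := 3, 2 := 2 ^ m, 3 := 2 ^ m)"
  define S where "S = (\<lambda>a. frag_cmul (int (d a)) (frag_of a)) ` {1, 2, 3, 4}"
  let ?a = "\<lambda>v. frag_of (Inl v) :: 'a + 'a \<Rightarrow>\<^sub>0 int" and ?g = "\<lambda>v. frag_of (Inr v) :: 'a + 'a \<Rightarrow>\<^sub>0 int"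
  let ?e = "\<lambda>n :: nat. frag_of n"
  have "coprime ((2 :: int) ^ m) (2 + 1)"
    by (rule coprime_power_left_iff [THEN iffD2, OF disjI1, OF coprime_add_one_right])
  then obtain s t where "s * 2 ^ m + t * (2 + 1) = (1 :: int)"
    by (metis bezout_int coprime_imp_gcd_eq_1)
  then have st: "s * 2 ^ m + t * 3 = 1"
    by simp
  then have sP: "s * 2 ^ m = 1 - t * 3"
    by simp
  define f where "f = case_sum
    (\<lambda>v. if v = x then ?e 4 else if v = y then ?e 4 + ?e 3 - ?e 1 - ?e 2 else ?e 4 + ?e 1 + ?e 2)
    (\<lambda>v. frag_cmul (2 ^ m) (if v = y then ?e 4 else if v = w then ?e 4 + ?e 3 - ?e 1 - ?e 2 else ?e 4 + ?e 1 + ?e 2))"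
  define f' where "f' = (\<lambda>n :: nat. if n = 4 then ?a x
    else if n = 1 then frag_cmul (s * 2 ^ m) (?a w - ?a x)
    else if n = 2 then frag_cmul (t * 3) (?a w - ?a x)
    else ?a y + ?a w - frag_cmul 2 (?a x))"
  have f: "f (Inl x) = ?e 4" "f (Inl y) = ?e 4 + ?e 3 - ?e 1 - ?e 2" "f (Inl w) = ?e 4 + ?e 1 + ?e 2"
    "f (Inr y) = frag_cmul (2 ^ m) (?e 4)" "f (Inr w) = frag_cmul (2 ^ m) (?e 4 + ?e 3 - ?e 1 - ?e 2)"
    "f (Inr x) = frag_cmul (2 ^ m) (?e 4 + ?e 1 + ?e 2)"
    using distinct by (auto simp: f_def)
  have f': "f' 4 = ?a x" "f' (Suc 0) = frag_cmul (s * 2 ^ m) (?a w - ?a x)"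
    "f' 2 = frag_cmul (t * 3) (?a w - ?a x)" "f' 3 = ?a y + ?a w - frag_cmul 2 (?a x)"
    by (auto simp: f'_def)
  have e1: "frag_cmul 3 (?e 1) \<in> frag.span S" and e2: "frag_cmul (2 ^ m) (?e 2) \<in> frag.span S"
    and e3: "frag_cmul (2 ^ m) (?e 3) \<in> frag.span S"
    unfolding S_def by (auto intro!: frag.span_base simp: d_def image_iff)
  have R: "frag_cmul 2 (?g v) - ?g (c v) - ?g (c' v) \<in> frag.span R"
    "frag_cmul (2 ^ m) (?a v) - ?g (c v) \<in> frag.span R" if "v \<in> ?V" for v
    using that by (auto intro!: frag.span_base simp: R_def divided_relators_def)
  have Rg: "frag_cmul 2 (?g x) - ?g y - ?g w \<in> frag.span R"
    "frag_cmul 2 (?g y) - ?g w - ?g x \<in> frag.span R"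
    using R(1) [of x] R(1) [of y] by (simp_all add: c c')
  have Ra: "frag_cmul (2 ^ m) (?a x) - ?g y \<in> frag.span R"
    "frag_cmul (2 ^ m) (?a y) - ?g w \<in> frag.span R" "frag_cmul (2 ^ m) (?a w) - ?g x \<in> frag.span R"
    using R(2) [of x] R(2) [of y] R(2) [of w] by (simp_all add: c c')
  \<comment> \<open>in additive notation, \<open>3 * 2 ^ m * b\<close> is \<open>3 * (g x - g y)\<close>, the difference of two Laplacian relators\<close>
  have combine: "frag_cmul 3 (frag_cmul k a - g) - frag_cmul 3 (frag_cmul k a' - g')
      + ((frag_cmul 2 g - g' - g'') - (frag_cmul 2 g' - g'' - g)) = frag_cmul (3 * k) (a - a')"
    for k and a a' g g' g'' :: "'a + 'a \<Rightarrow>\<^sub>0 int"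
    by (rule poly_mapping_eqI, simp only: lookup_add lookup_minus lookup_frag_cmul, simp add: algebra_simps)
  have "frag_cmul 3 (frag_cmul (2 ^ m) (?a w) - ?g x) - frag_cmul 3 (frag_cmul (2 ^ m) (?a x) - ?g y)
      + ((frag_cmul 2 (?g x) - ?g y - ?g w) - (frag_cmul 2 (?g y) - ?g w - ?g x)) \<in> frag.span R"
    by (intro frag.span_add [OF frag.span_diff frag.span_diff] frag.span_scale Ra Rg)
  also have "frag_cmul 3 (frag_cmul (2 ^ m) (?a w) - ?g x) - frag_cmul 3 (frag_cmul (2 ^ m) (?a x) - ?g y)
      + ((frag_cmul 2 (?g x) - ?g y - ?g w) - (frag_cmul 2 (?g y) - ?g w - ?g x))
      = frag_cmul (3 * 2 ^ m) (?a w - ?a x)"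
    by (rule combine)
  finally have D: "frag_cmul (3 * 2 ^ m) (?a w - ?a x) \<in> frag.span R" .
  have V: "c ` ?V \<subseteq> ?V" "c' ` ?V \<subseteq> ?V"
    using c c' by auto
  have "presented_group (?V <+> ?V) R \<cong> presented_group {1, 2, 3, 4} S"
  proof (rule presented_group_isoI)
    show "R \<subseteq> carrier (free_Abelian_group (?V <+> ?V))"
      unfolding R_def by (intro divided_relators_closed V)
    show "S \<subseteq> carrier (free_Abelian_group {1, 2, 3, 4})"
      by (auto simp: S_def)
  next
    fix u assume u: "u \<in> ?V <+> ?V"
    show "Poly_Mapping.keys (f u) \<subseteq> {1, 2, 3, 4}"
      unfolding f_def by (auto split: sum.splits if_splits dest!: keys_dests)
    have aw: "frag_cmul (s * 2 ^ m) z + frag_cmul (t * 3) z = z" for z :: "'a + 'a \<Rightarrow>\<^sub>0 int"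
      using st by (simp flip: frag_cmul_distrib)
    have "frag_extend f' (f (Inl w)) - ?a w =
        (frag_cmul (s * 2 ^ m) (?a w - ?a x) + frag_cmul (t * 3) (?a w - ?a x)) - (?a w - ?a x)"
      by (simp add: f f' frag_extend_simps)
    then have w: "frag_extend f' (f (Inl w)) = ?a w"
      unfolding aw by simp
    have "frag_extend f' (f (Inl y)) - ?a y = (?a w - ?a x) -
        (frag_cmul (s * 2 ^ m) (?a w - ?a x) + frag_cmul (t * 3) (?a w - ?a x))"
      by (simp add: f f' frag_extend_simps frag_cmul_2)
    then have y: "frag_extend f' (f (Inl y)) = ?a y"
      unfolding aw by simp
    have x: "frag_extend f' (f (Inl x)) = ?a x"
      by (simp add: f f')
    have g: "f (Inr x) = frag_cmul (2 ^ m) (f (Inl w))" "f (Inr y) = frag_cmul (2 ^ m) (f (Inl x))"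
      "f (Inr w) = frag_cmul (2 ^ m) (f (Inl y))"
      by (simp_all add: f)
    consider "u = Inl x" | "u = Inl y" | "u = Inl w" | "u = Inr x" | "u = Inr y" | "u = Inr w"
      using u by auto
    then show "frag_extend f' (f u) - frag_of u \<in> frag.span R"
      using Ra
      by cases (simp_all add: x y w g frag_extend_cmul c frag.span_zero)
  next
    fix n :: nat assume n: "n \<in> {1, 2, 3, 4}"
    show "Poly_Mapping.keys (f' n) \<subseteq> ?V <+> ?V"
      unfolding f'_def by (auto split: if_splits dest!: keys_dests)
    have st': "s * 2 ^ m * (k + l) - k = s * (2 ^ m * l) - t * (3 * k)"
      "t * 3 * (k + l) - l = t * (3 * k) - s * (2 ^ m * l)" for k l :: int
      unfolding mult.assoc [symmetric] sP by (simp_all add: algebra_simps)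
    have "frag_extend f (f' 1) = frag_cmul (s * 2 ^ m) (?e 1 + ?e 2)"
      by (simp add: f f' frag_extend_simps)
    then have "frag_extend f (f' 1) - ?e 1 = frag_cmul s (frag_cmul (2 ^ m) (?e 2)) - frag_cmul t (frag_cmul 3 (?e 1))"
      by (intro poly_mapping_eqI)
        (simp only: lookup_add lookup_minus lookup_frag_cmul st')
    then have 1: "frag_extend f (f' 1) - ?e 1 \<in> frag.span S"
      by (simp only:) (intro frag.span_diff frag.span_scale e1 e2)
    have "frag_extend f (f' 2) = frag_cmul (t * 3) (?e 1 + ?e 2)"
      by (simp add: f f' frag_extend_simps)
    then have "frag_extend f (f' 2) - ?e 2 = frag_cmul t (frag_cmul 3 (?e 1)) - frag_cmul s (frag_cmul (2 ^ m) (?e 2))"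
      by (intro poly_mapping_eqI)
        (simp only: lookup_add lookup_minus lookup_frag_cmul st')
    then have 2: "frag_extend f (f' 2) - ?e 2 \<in> frag.span S"
      by (simp only:) (intro frag.span_diff frag.span_scale e1 e2)
    show "frag_extend f (f' n) - frag_of n \<in> frag.span S"
      using n 1 2 by (auto simp: f f' frag_extend_simps frag.span_zero frag_cmul_2)
  next
    fix r assume "r \<in> R"
    then consider (g) v where "v \<in> ?V" "r = frag_cmul 2 (?g v) - ?g (c v) - ?g (c' v)"
      | (a) v where "v \<in> ?V" "r = frag_cmul (2 ^ m) (?a v) - ?g (c v)"
      unfolding R_def divided_relators_def by auto
    then show "frag_extend f r \<in> frag.span S"
    proof cases
      case g
      consider "v = x" | "v = y" | "v = w"
        using g by auto
      then have "\<exists>b b'. frag_extend f r = frag_cmul (b * 2 ^ m) (frag_cmul 3 (?e 1)) +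
          frag_cmul (3 * b) (frag_cmul (2 ^ m) (?e 2)) + frag_cmul b' (frag_cmul (2 ^ m) (?e 3))"
      proof cases
        case 1
        have "frag_cmul 2 (frag_cmul k (e0 + e1 + e2)) - frag_cmul k e0 - frag_cmul k (e0 + e3 - e1 - e2) =
            frag_cmul (1 * k) (frag_cmul 3 e1) + frag_cmul (3 * 1) (frag_cmul k e2) + frag_cmul (- 1) (frag_cmul k e3)"
          for k and e0 e1 e2 e3 :: "nat \<Rightarrow>\<^sub>0 int"
          by (rule poly_mapping_eqI, simp only: lookup_add lookup_minus lookup_frag_cmul, simp add: algebra_simps)
        then show ?thesis
          unfolding g(2) 1 c c' frag_extend_simps frag_extend_of f by blast
      next
        case 2
        have "frag_cmul 2 (frag_cmul k e0) - frag_cmul k (e0 + e3 - e1 - e2) - frag_cmul k (e0 + e1 + e2) =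
            frag_cmul (0 * k) (frag_cmul 3 e1) + frag_cmul (3 * 0) (frag_cmul k e2) + frag_cmul (- 1) (frag_cmul k e3)"
          for k and e0 e1 e2 e3 :: "nat \<Rightarrow>\<^sub>0 int"
          by (rule poly_mapping_eqI, simp only: lookup_add lookup_minus lookup_frag_cmul, simp add: algebra_simps)
        then show ?thesis
          unfolding g(2) 2 c c' frag_extend_simps frag_extend_of f by blast
      next
        case 3
        have "frag_cmul 2 (frag_cmul k (e0 + e3 - e1 - e2)) - frag_cmul k (e0 + e1 + e2) - frag_cmul k e0 =
            frag_cmul (- 1 * k) (frag_cmul 3 e1) + frag_cmul (3 * - 1) (frag_cmul k e2) + frag_cmul 2 (frag_cmul k e3)"
          for k and e0 e1 e2 e3 :: "nat \<Rightarrow>\<^sub>0 int"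
          by (rule poly_mapping_eqI, simp only: lookup_add lookup_minus lookup_frag_cmul, simp add: algebra_simps)
        then show ?thesis
          unfolding g(2) 3 c c' frag_extend_simps frag_extend_of f by blast
      qed
      then obtain b b' where "frag_extend f r = frag_cmul (b * 2 ^ m) (frag_cmul 3 (?e 1)) +
          frag_cmul (3 * b) (frag_cmul (2 ^ m) (?e 2)) + frag_cmul b' (frag_cmul (2 ^ m) (?e 3))"
        by blast
      then show ?thesis
        by (simp only:) (intro frag.span_add frag.span_scale e1 e2 e3)
    next
      case a
      then show ?thesis
        by (auto simp: f c frag_extend_simps frag.span_zero)
    qed
  next
    fix r assume "r \<in> S"
    then consider "r = 0" | "r = frag_cmul 3 (?e 1)" | "r = frag_cmul (2 ^ m) (?e 2)" | "r = frag_cmul (2 ^ m) (?e 3)"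
      by (auto simp: S_def d_def)
    then show "frag_extend f' r \<in> frag.span R"
    proof cases
      case 2
      then show ?thesis
        using frag.span_scale [OF D, of s] by (simp add: f' frag_extend_cmul ac_simps)
    next
      case 3
      then show ?thesis
        using frag.span_scale [OF D, of t] by (simp add: f' frag_extend_cmul ac_simps)
    next
      case 4
      have combine: "frag_cmul k (a' + a'' - frag_cmul 2 a) = (frag_cmul k a' - g'') + (frag_cmul k a'' - g)
          - frag_cmul 2 (frag_cmul k a - g') - (frag_cmul 2 g' - g'' - g)"
        for k and a a' a'' g g' g'' :: "'a + 'a \<Rightarrow>\<^sub>0 int"
        by (rule poly_mapping_eqI, simp only: lookup_add lookup_minus lookup_frag_cmul, simp add: algebra_simps)
      have "frag_extend f' r = (frag_cmul (2 ^ m) (?a y) - ?g w) + (frag_cmul (2 ^ m) (?a w) - ?g x)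
          - frag_cmul 2 (frag_cmul (2 ^ m) (?a x) - ?g y) - (frag_cmul 2 (?g y) - ?g w - ?g x)"
        unfolding 4 frag_extend_simps frag_extend_of f' by (rule combine)
      also have "\<dots> \<in> frag.span R"
        by (intro frag.span_diff [OF frag.span_diff [OF frag.span_add]] frag.span_scale Ra Rg)
      finally show ?thesis .
    qed (simp add: frag.span_zero)
  qed
  also have "\<dots> \<cong> sum_group {1, 2, 3, 4} (\<lambda>a. integer_mod_group (d a))"
    unfolding S_def by (rule presented_group_cyclic)
  also have "\<dots> \<cong> cyclic_sum (\<Sum>a\<in>{1, 2, 3, 4}. {#d a#})"
    by (intro sum_group_iso_cyclic_sum cyclic_sum_single) auto
  also have "(\<Sum>a\<in>{1, 2, 3, 4}. {#d a#}) = {#0, 3, 2 ^ m, 2 ^ m#}"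
    by (simp add: d_def)
  finally show ?thesis
    by (simp add: divided_group_def R_def)
qed

section \<open>Removing the infinite cyclic summand\<close>

text \<open>Let \<open>\<phi> = (\<alpha>, \<beta>)\<close> be the epimorphism onto \<open>T \<times> \<int>\<close>. If \<open>\<beta> x = 0\<close>, a positive multiple of \<open>x\<close> is killed by \<open>\<phi>\<close> because
  \<open>T\<close> is finite; that multiple is a combination of relators, so \<open>x\<close> has degree zero. Hence \<open>\<beta>\<close> is a
  multiple of the degree. Then \<open>x \<mapsto> \<alpha> (x - deg x * r)\<close> is onto \<open>T\<close>, and its kernel is generated by the
  relators and \<open>r\<close>. In particular the choice of \<open>r\<close> does not affect the quotient up to isomorphism.\<close>

lemma presented_group_degree_zero:
  fixes V :: "'a set" and T :: "('b, 'c) monoid_scheme"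
  assumes "group T" and "finite (carrier T)"
    and iso: "presented_group V R \<cong> T \<times>\<times> integer_mod_group 0"
    and R: "R \<subseteq> carrier (free_Abelian_group V)" and r: "r \<in> V"
    and deg_R: "\<And>\<rho>. \<rho> \<in> R \<Longrightarrow> frag_extend (\<lambda>_. frag_of ()) \<rho> = 0"
  shows "presented_group V (insert (frag_of r) R) \<cong> T"
proof -
  let ?F = "free_Abelian_group V" and ?Z = "integer_mod_group 0"
  interpret T: group T by fact
  have group: "group (T \<times>\<times> ?Z)"
    by (intro DirProd_group) auto
  obtain \<phi> where \<phi>: "\<phi> \<in> hom ?F (T \<times>\<times> ?Z)"
    and surj: "carrier (T \<times>\<times> ?Z) \<subseteq> \<phi> ` carrier ?F"
    and ker: "\<And>x. Poly_Mapping.keys x \<subseteq> V \<Longrightarrow> \<phi> x = \<one>\<^bsub>T \<times>\<times> ?Z\<^esub> \<longleftrightarrow> x \<in> frag.span R"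
    using epi_if_presented_group_iso [OF iso group R] by metis
  define \<alpha> where "\<alpha> = fst \<circ> \<phi>"
  define \<beta> where "\<beta> = snd \<circ> \<phi>"
  have \<phi>_eq: "\<phi> x = (\<alpha> x, \<beta> x)" for x
    by (simp add: \<alpha>_def \<beta>_def)
  have \<alpha>: "\<alpha> \<in> hom ?F T" and \<beta>: "\<beta> \<in> hom ?F ?Z"
    using \<phi> unfolding hom_pairwise \<alpha>_def \<beta>_def by auto
  interpret \<alpha>: group_hom ?F T \<alpha>
    using \<alpha> by (simp add: group_hom_def group_hom_axioms_def T.group_axioms)
  interpret \<beta>: group_hom ?F ?Z \<beta>
    using \<beta> by (simp add: group_hom_def group_hom_axioms_def)
  have \<alpha>_cmul: "\<alpha> (frag_cmul k x) = \<alpha> x [^]\<^bsub>T\<^esub> k" if "Poly_Mapping.keys x \<subseteq> V" for k :: int and x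
    using \<alpha>.hom_int_pow [of x k] that by (simp add: int_pow_free_Abelian_group)
  have \<beta>_cmul: "\<beta> (frag_cmul k x) = k * \<beta> x" if "Poly_Mapping.keys x \<subseteq> V" for k x
    using \<beta>.hom_int_pow [of x k] that by (simp add: int_pow_free_Abelian_group int_pow_integer_mod_group)
  have \<beta>_diff: "\<beta> (x - y) = \<beta> x - \<beta> y" if "Poly_Mapping.keys x \<subseteq> V" "Poly_Mapping.keys y \<subseteq> V" for x y
    using \<beta>.hom_mult [of x "- y"] \<beta>_cmul [of y "- 1"] that by simp
  define deg where "deg x = Poly_Mapping.lookup (frag_extend (\<lambda>_. frag_of ()) x) ()" for x :: "'a \<Rightarrow>\<^sub>0 int"
  have deg_simps: "deg (x - y) = deg x - deg y" "deg (frag_cmul k x) = k * deg x" "deg (frag_of v) = 1" for x y k v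
    by (simp_all add: deg_def frag_extend_simps lookup_minus)
  have deg_span: "deg x = 0" if "x \<in> frag.span R" for x
    using frag_extend_span [of R "\<lambda>_. frag_of ()" "{}" x] deg_R that by (simp add: deg_def)
  have deg_ker: "deg x = 0" if x: "Poly_Mapping.keys x \<subseteq> V" and "\<beta> x = 0" for x
  proof -
    have "\<alpha> x \<in> carrier T"
      using \<alpha>.hom_closed x by simp
    then have "\<alpha> (frag_cmul (int (order T)) x) = \<one>\<^bsub>T\<^esub>"
      using x by (simp add: \<alpha>_cmul int_pow_int T.pow_order_eq_1)
    moreover have "\<beta> (frag_cmul (int (order T)) x) = 0"
      using that by (simp add: \<beta>_cmul)
    moreover have "Poly_Mapping.keys (frag_cmul (int (order T)) x) \<subseteq> V"
      using x by (auto simp: keys_cmul_iff)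
    ultimately have "frag_cmul (int (order T)) x \<in> frag.span R"
      using ker [of "frag_cmul (int (order T)) x"] by (simp add: \<phi>_eq del: keys_cmul_iff)
    moreover have "order T > 0"
      using assms(2) T.order_gt_0_iff_finite by blast
    ultimately show ?thesis
      using deg_span deg_simps(2) by fastforce
  qed
  have \<beta>_deg: "\<beta> x = \<beta> (frag_of r) * deg x" if x: "Poly_Mapping.keys x \<subseteq> V" for x
  proof -
    \<comment> \<open>\<open>?y\<close> lies in the kernel of \<open>\<beta>\<close>, so its degree vanishes; \<open>frag_of r\<close> has degree one\<close>
    let ?y = "frag_cmul (\<beta> (frag_of r)) x - frag_cmul (\<beta> x) (frag_of r)"
    have keys: "Poly_Mapping.keys (frag_cmul (\<beta> (frag_of r)) x) \<subseteq> V"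
      "Poly_Mapping.keys (frag_cmul (\<beta> x) (frag_of r)) \<subseteq> V"
      using x r by auto
    have "\<beta> ?y = 0"
      using x r by (simp add: \<beta>_diff [OF keys] \<beta>_cmul del: keys_single) (simp add: \<beta>_cmul)
    then have "deg ?y = 0"
      using keys by (intro deg_ker) (auto dest!: keys_dests)
    then show ?thesis
      by (simp add: deg_simps)
  qed
  define \<pi> where "\<pi> = frag_extend (\<lambda>v. frag_of v - frag_of r)"
  have \<pi>_eq: "\<pi> x = x - frag_cmul (deg x) (frag_of r)" for x
    using subset_UNIV [of "Poly_Mapping.keys x"]
  proof (induction rule: frag_induction)
    case (diff a b)
    have "\<pi> (a - b) = \<pi> a - \<pi> b"
      by (simp add: \<pi>_def frag_extend_diff)
    then show ?case
      by (simp add: diff deg_simps frag_cmul_diff_distrib)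
  qed (simp_all add: \<pi>_def deg_def)
  have \<pi>_closed: "Poly_Mapping.keys (\<pi> x) \<subseteq> V" if "Poly_Mapping.keys x \<subseteq> V" for x
    unfolding \<pi>_def using r that
    by (intro frag_extend_closed [where A = V]) (auto dest!: keys_dests)
  show ?thesis
  proof (rule presented_group_iso_if_epi)
    have "\<pi> \<in> hom ?F ?F"
      using \<pi>_closed by (intro homI) (auto simp: \<pi>_def frag_extend_add)
    then show "\<alpha> \<circ> \<pi> \<in> hom ?F T"
      using \<alpha> by (rule hom_compose)
    show "carrier T \<subseteq> (\<alpha> \<circ> \<pi>) ` carrier ?F"
    proof
      fix t assume "t \<in> carrier T"
      then have "(t, 0) \<in> carrier (T \<times>\<times> ?Z)"
        by (simp add: carrier_integer_mod_group)
      then obtain x where x: "Poly_Mapping.keys x \<subseteq> V" "(t, 0) = \<phi> x"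
        using subsetD [OF surj, of "(t, 0)"] by force
      then have "deg x = 0"
        by (intro deg_ker) (simp_all add: \<phi>_eq)
      then show "t \<in> (\<alpha> \<circ> \<pi>) ` carrier ?F"
        using x by (intro image_eqI [of _ _ x]) (simp_all add: \<pi>_eq \<phi>_eq)
    qed
    show "insert (frag_of r) R \<subseteq> carrier ?F"
      using r R by auto
    show "(\<alpha> \<circ> \<pi>) x = \<one>\<^bsub>T\<^esub> \<longleftrightarrow> x \<in> frag.span (insert (frag_of r) R)"
      if x: "Poly_Mapping.keys x \<subseteq> V" for x
    proof
      assume "(\<alpha> \<circ> \<pi>) x = \<one>\<^bsub>T\<^esub>"
      moreover have "\<beta> (\<pi> x) = 0"
        using \<beta>_deg [OF \<pi>_closed [OF x]] by (simp add: \<pi>_eq deg_simps)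
      ultimately have "\<pi> x \<in> frag.span R"
        using ker [OF \<pi>_closed [OF x]] by (simp add: \<phi>_eq)
      then have "\<pi> x + frag_cmul (deg x) (frag_of r) \<in> frag.span (insert (frag_of r) R)"
        using frag.span_mono [of R "insert (frag_of r) R"]
        by (intro frag.span_add frag.span_scale frag.span_base [of "frag_of r"]) auto
      then show "x \<in> frag.span (insert (frag_of r) R)"
        by (simp add: \<pi>_eq)
    next
      assume x_span: "x \<in> frag.span (insert (frag_of r) R)"
      have "\<pi> \<rho> \<in> frag.span R" if "\<rho> \<in> insert (frag_of r) R" for \<rho>
        using that deg_span frag.span_base [of \<rho> R]
        by (auto simp: \<pi>_eq deg_simps frag.span_zero)
      then have "\<pi> x \<in> frag.span R"
        unfolding \<pi>_def by (rule frag_extend_span [OF _ x_span])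
      then have "\<phi> (\<pi> x) = \<one>\<^bsub>T \<times>\<times> ?Z\<^esub>"
        using ker [OF \<pi>_closed [OF x]] by blast
      then show "(\<alpha> \<circ> \<pi>) x = \<one>\<^bsub>T\<^esub>"
        by (simp add: \<phi>_eq)
    qed
  qed (rule T.group_axioms)
qed

section \<open>Kautz graphs\<close>

abbreviation two_regular_digraph ::
    "('v, 'e) pre_digraph \<Rightarrow> ('v \<Rightarrow> 'e) \<Rightarrow> ('v \<Rightarrow> 'e) \<Rightarrow> ('v \<Rightarrow> 'e) \<Rightarrow> ('v \<Rightarrow> 'e) \<Rightarrow> bool" where
  "two_regular_digraph G \<equiv> two_regular (verts G) (arcs G) (tail G) (head G)"

context two_regular
begin

lemma arcs_eq: "E = p ` V \<union> q ` V"
  by (auto elim: out_cases)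

lemma finite_arcs: "finite E"
  by (simp add: arcs_eq finite_V)

lemma card_arcs: "card E = 2 * card V"
proof -
  have "inj_on p V" "inj_on q V"
    by (metis inj_on_inverseI out_simps(3), metis inj_on_inverseI out_simps(4))
  moreover have "p ` V \<inter> q ` V = {}"
  proof (intro equals0I, elim IntE imageE)
    fix e v w assume "v \<in> V" "w \<in> V" and eq: "e = p v" "e = q w"
    then have "v = w"
      by (metis out_simps(3,4))
    with \<open>v \<in> V\<close> eq show False
      by simp
  qed
  ultimately show ?thesis
    by (simp add: arcs_eq card_Un_disjoint finite_V card_image)
qed

text \<open>Both sides are the sum over all arcs, grouped by tails and by heads.\<close>

lemma sum_out_eq_sum_in:
  fixes h :: "'e \<Rightarrow> 'c :: comm_monoid_add"
  shows "(\<Sum>v\<in>V. h (p v) + h (q v)) = (\<Sum>v\<in>V. h (i v) + h (j v))"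
proof -
  have "(\<Sum>v\<in>V. h (p v) + h (q v)) = (\<Sum>v\<in>V. \<Sum>e\<in>{e \<in> E. tl e = v}. h e)"
    by (intro sum.cong) (simp_all add: out_arcs)
  also have "\<dots> = (\<Sum>v\<in>V. \<Sum>e\<in>{e \<in> E. hd e = v}. h e)"
    using finite_V finite_arcs by (subst (1 2) sum.group) (auto simp: tl_closed hd_closed)
  also have "\<dots> = (\<Sum>v\<in>V. h (i v) + h (j v))"
    by (intro sum.cong) (simp_all add: in_arcs)
  finally show ?thesis .
qed

definition balance_relators :: "('v \<Rightarrow>\<^sub>0 int) set" where
  "balance_relators = (\<lambda>v. frag_cmul 2 (frag_of v) - frag_of (hd (p v)) - frag_of (hd (q v))) ` V"

lemma balance_relators_closed: "balance_relators \<subseteq> carrier (free_Abelian_group V)"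
  by (auto simp: balance_relators_def hd_closed dest!: keys_dests)

text \<open>Indegree equals outdegree. This makes the relator at any one vertex redundant, and so the relator
  that the sandpile lattice omits at the root may be added back.\<close>

lemma sum_balance_relators:
  "(\<Sum>v\<in>V. frag_cmul 2 (frag_of v) - frag_of (hd (p v)) - frag_of (hd (q v))) = 0"
proof -
  have "(\<Sum>v\<in>V. frag_of (hd (p v)) + frag_of (hd (q v))) = (\<Sum>v\<in>V. frag_cmul 2 (frag_of v))"
    using sum_out_eq_sum_in [of "\<lambda>e. frag_of (hd e)"] by (simp add: frag_cmul_2)
  then show ?thesis
    by (simp add: sum_subtractf sum.distrib diff_diff_eq)
qed

end

lemma line_digraph_simps [simp]:
  "verts (line_digraph G) = arcs G" "tail (line_digraph G) = opfst" "head (line_digraph G) = opsnd"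
  by (simp_all add: line_digraph_def)

lemma arcs_line_digraph_iff [simp]:
  "OPair e e' \<in> arcs (line_digraph G) \<longleftrightarrow> e \<in> arcs G \<and> e' \<in> arcs G \<and> tail G e' = head G e"
  by (simp add: line_digraph_def)

lemma arcs_line_digraph_cases:
  assumes "f \<in> arcs (line_digraph G)"
  obtains e e' where "f = OPair e e'" "e \<in> arcs G" "e' \<in> arcs G" "tail G e' = head G e"
  using assms unfolding line_digraph_def by auto

lemma two_regular_line_digraph:
  assumes "two_regular_digraph G p q i j"
  shows "two_regular_digraph (line_digraph G)
    (\<lambda>e. OPair e (p (head G e))) (\<lambda>e. OPair e (q (head G e)))
    (\<lambda>e. OPair (i (tail G e)) e) (\<lambda>e. OPair (j (tail G e)) e)"
proof -
  interpret two_regular "verts G" "arcs G" "tail G" "head G" p q i j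
    by (rule assms)
  have out: "f = p (head G e) \<or> f = q (head G e)" if "e \<in> arcs G" "f \<in> arcs G" "tail G f = head G e" for e f
  proof -
    have "f \<in> {f \<in> arcs G. tail G f = head G e}"
      using that by simp
    then show ?thesis
      unfolding out_arcs [OF hd_closed [OF that(1)]] by simp
  qed
  have into: "f = i (tail G e) \<or> f = j (tail G e)" if "e \<in> arcs G" "f \<in> arcs G" "tail G e = head G f" for e f
  proof -
    have "f \<in> {f \<in> arcs G. head G f = tail G e}"
      using that by simp
    then show ?thesis
      unfolding in_arcs [OF tl_closed [OF that(1)]] by simp
  qed
  show ?thesis
  proof
    show "finite (verts (line_digraph G))"
      by (simp add: finite_arcs)
    fix e assume "e \<in> verts (line_digraph G)"
    then have e: "e \<in> arcs G"
      by simp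
    show "{f \<in> arcs (line_digraph G). tail (line_digraph G) f = e} =
        {OPair e (p (head G e)), OPair e (q (head G e))}"
    proof (intro equalityI subsetI)
      fix f assume "f \<in> {f \<in> arcs (line_digraph G). tail (line_digraph G) f = e}"
      then obtain e' where "f = OPair e e'" "e' \<in> arcs G" "tail G e' = head G e"
        by (auto elim: arcs_line_digraph_cases)
      with out [OF e, of e'] show "f \<in> {OPair e (p (head G e)), OPair e (q (head G e))}"
        by simp
    qed (use e hd_closed in auto)
    show "{f \<in> arcs (line_digraph G). head (line_digraph G) f = e} =
        {OPair (i (tail G e)) e, OPair (j (tail G e)) e}"
    proof (intro equalityI subsetI)
      fix f assume "f \<in> {f \<in> arcs (line_digraph G). head (line_digraph G) f = e}"
      then obtain e' where "f = OPair e' e" "e' \<in> arcs G" "tail G e = head G e'"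
        by (auto elim: arcs_line_digraph_cases)
      with into [OF e, of e'] show "f \<in> {OPair (i (tail G e)) e, OPair (j (tail G e)) e}"
        by simp
    qed (use e tl_closed in auto)
    show "OPair e (p (head G e)) \<noteq> OPair e (q (head G e))"
      "OPair (i (tail G e)) e \<noteq> OPair (j (tail G e)) e"
      using e tl_closed hd_closed by auto
  qed (auto elim: arcs_line_digraph_cases)
qed

lemma divided_group_line_digraph_iso:
  assumes "two_regular_digraph G p q i j"
  shows "divided_group (verts (line_digraph G)) (head (line_digraph G) \<circ> (\<lambda>e. OPair e (p (head G e))))
      (head (line_digraph G) \<circ> (\<lambda>e. OPair e (q (head G e)))) k \<cong>
    divided_group (verts G) (head G \<circ> p) (head G \<circ> q) (Suc k) \<times>\<times>
    sum_group (verts G) (\<lambda>_. integer_mod_group (2 ^ k))"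
  using two_regular.divided_group_line_iso [OF assms, of k]
  by (simp add: comp_def)

lemma kautz_Suc_Suc: "kautz (Suc (Suc m)) = line_digraph (kautz (Suc m))"
  using kautz_rec [of "Suc (Suc m)"] by simp

text \<open>A line graph step for \<open>k\<close> uses the decomposition one level below for \<open>Suc k\<close>, so the induction is
  over all \<open>k\<close> together.\<close>

lemma divided_group_kautz_iso:
  "\<exists>p q i j. two_regular_digraph (kautz (Suc m)) p q i j \<and> card (verts (kautz (Suc m))) = 3 * 2 ^ m \<and>
    (\<forall>k. divided_group (verts (kautz (Suc m))) (head (kautz (Suc m)) \<circ> p) (head (kautz (Suc m)) \<circ> q) k \<cong>
      cyclic_sum ({#0, 3, 2 ^ (k + m), 2 ^ (k + m)#} +
        (\<Sum>l<m. replicate_mset (3 * 2 ^ (m - Suc l)) (2 ^ (k + l)))))"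
proof (induction m)
  case 0
  let ?x = "Atom (1 :: nat)" and ?y = "Atom (2 :: nat)" and ?w = "Atom (3 :: nat)"
  \<comment> \<open>choosing the out-arcs along \<open>fwd\<close> makes the chosen out-neighbours a rotation of the triangle\<close>
  define fwd where "fwd v = (if v = ?x then ?y else if v = ?y then ?w else ?x)" for v
  define bwd where "bwd v = (if v = ?x then ?w else if v = ?y then ?x else ?y)" for v
  let ?p = "\<lambda>v. OPair v (fwd v)" and ?q = "\<lambda>v. OPair v (bwd v)"
  let ?i = "\<lambda>v. OPair (bwd v) v" and ?j = "\<lambda>v. OPair (fwd v) v"
  have kautz: "kautz (Suc 0) = kautz1"
    using kautz_1 by simp
  have verts: "verts kautz1 = {?x, ?y, ?w}"
    and arcs: "arcs kautz1 = {OPair ?x ?y, OPair ?x ?w, OPair ?y ?x, OPair ?y ?w, OPair ?w ?x, OPair ?w ?y}"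
    and maps: "tail kautz1 = opfst" "head kautz1 = opsnd"
    by (auto simp: kautz1_def)
  have "two_regular_digraph kautz1 ?p ?q ?i ?j"
    unfolding two_regular_def verts arcs maps fwd_def bwd_def by auto
  moreover have "divided_group (verts kautz1) (head kautz1 \<circ> ?p) (head kautz1 \<circ> ?q) k \<cong>
      cyclic_sum {#0, 3, 2 ^ k, 2 ^ k#}" for k
    unfolding verts maps by (rule divided_group_triangle_iso) (auto simp: fwd_def bwd_def)
  moreover have "card (verts kautz1) = 3"
    by (simp add: verts)
  ultimately show ?case
    unfolding kautz by - (rule exI [of _ ?p], rule exI [of _ ?q], rule exI [of _ ?i], rule exI [of _ ?j], simp add: comp_def)
next
  case (Suc m)
  let ?G = "kautz (Suc m)"
  obtain p q i j where reg: "two_regular_digraph ?G p q i j" and card: "card (verts ?G) = 3 * 2 ^ m"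
    and iso: "\<And>k. divided_group (verts ?G) (head ?G \<circ> p) (head ?G \<circ> q) k \<cong>
      cyclic_sum ({#0, 3, 2 ^ (k + m), 2 ^ (k + m)#} +
        (\<Sum>l<m. replicate_mset (3 * 2 ^ (m - Suc l)) (2 ^ (k + l))))"
    using Suc.IH by blast
  interpret two_regular "verts ?G" "arcs ?G" "tail ?G" "head ?G" p q i j
    by (rule reg)
  let ?p = "\<lambda>e. OPair e (p (head ?G e))" and ?q = "\<lambda>e. OPair e (q (head ?G e))"
  let ?H = "line_digraph ?G"
  have "divided_group (verts ?H) (head ?H \<circ> ?p) (head ?H \<circ> ?q) k \<cong>
      cyclic_sum ({#0, 3, 2 ^ (k + Suc m), 2 ^ (k + Suc m)#} +
        (\<Sum>l<Suc m. replicate_mset (3 * 2 ^ (Suc m - Suc l)) (2 ^ (k + l))))" for k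
  proof -
    have "divided_group (verts ?H) (head ?H \<circ> ?p) (head ?H \<circ> ?q) k \<cong>
        divided_group (verts ?G) (head ?G \<circ> p) (head ?G \<circ> q) (Suc k) \<times>\<times>
        sum_group (verts ?G) (\<lambda>_. integer_mod_group (2 ^ k))"
      by (rule divided_group_line_digraph_iso [OF reg])
    also have "\<dots> \<cong> cyclic_sum (({#0, 3, 2 ^ (Suc k + m), 2 ^ (Suc k + m)#} +
        (\<Sum>l<m. replicate_mset (3 * 2 ^ (m - Suc l)) (2 ^ (Suc k + l)))) +
        replicate_mset (card (verts ?G)) (2 ^ k))"
      by (intro DirProd_iso_cyclic_sum iso sum_group_const_iso_cyclic_sum finite_V group_divided_group)
        (auto simp: hd_closed)
    finally show ?thesis
      by (simp add: sum.lessThan_Suc_shift card ac_simps del: sum.lessThan_Suc)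
  qed
  moreover have "card (verts ?H) = 3 * 2 ^ Suc m"
    using card_arcs card by (simp add: line_digraph_def)
  ultimately show ?case
    unfolding kautz_Suc_Suc using two_regular_line_digraph [OF reg] by blast
qed

section \<open>Sandpile groups\<close>

lemma (in two_regular) span_insert_root:
  assumes "r \<in> V"
  shows "frag.span (insert (frag_of r) ((\<lambda>v. - (frag_cmul 2 (frag_of v) - frag_of (hd (p v)) - frag_of (hd (q v)))) ` (V - {r}))) =
    frag.span (insert (frag_of r) balance_relators)" (is "frag.span ?D = frag.span ?B")
proof -
  let ?\<Delta> = "\<lambda>v. frag_cmul 2 (frag_of v) - frag_of (hd (p v)) - frag_of (hd (q v))"
  have D: "?\<Delta> v \<in> frag.span ?D" if "v \<in> V - {r}" for v
  proof -
    have "- ?\<Delta> v \<in> frag.span ?D"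
      using that by (intro frag.span_base) blast
    then show ?thesis
      using frag.span_neg by fastforce
  qed
  have "?\<Delta> r = - (\<Sum>v\<in>V - {r}. ?\<Delta> v)"
    using sum_balance_relators sum.remove [OF finite_V assms, of ?\<Delta>] by (simp add: eq_neg_iff_add_eq_0)
  then have "?\<Delta> r \<in> frag.span ?D"
    by (simp only:) (intro frag.span_neg frag.span_sum D)
  then have "?B \<subseteq> frag.span ?D"
    using D frag.span_base [of "frag_of r" ?D] unfolding balance_relators_def by blast
  moreover have "?D \<subseteq> frag.span ?B"
    unfolding balance_relators_def by (auto intro!: frag.span_neg intro: frag.span_base simp del: minus_diff_eq)
  ultimately show ?thesis
    by (simp add: frag.span_eq)
qed

lemma sandpile_group_two_regular:
  assumes "two_regular_digraph G p q i j" and r: "r \<in> verts G"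
  shows "sandpile_group G r =
    presented_group (verts G) (insert (frag_of r) (two_regular.balance_relators (verts G) (head G) p q))"
proof -
  interpret two_regular "verts G" "arcs G" "tail G" "head G" p q i j
    by (rule assms)
  let ?F = "free_Abelian_group (verts G)"
  let ?D = "insert (frag_of r) ((\<lambda>v. - (frag_cmul 2 (frag_of v) - frag_of (head G (p v)) - frag_of (head G (q v)))) ` (verts G - {r}))"
  have "sandpile_delta G v = - (frag_cmul 2 (frag_of v) - frag_of (head G (p v)) - frag_of (head G (q v)))"
    if "v \<in> verts G" for v
    using that by (simp add: sandpile_delta_def out_arcs frag_cmul_2)
  then have "insert (frag_of r) (sandpile_delta G ` (verts G - {r})) = ?D"
    by auto
  moreover have "?D \<subseteq> carrier ?F"
    using r by (auto simp: hd_closed dest!: keys_dests)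
  ultimately show ?thesis
    unfolding sandpile_group_def sandpile_lattice_def presented_group_def
    by (simp only: span_eq_generate span_insert_root [OF r])
qed

lemma finite_cyclic_sum:
  assumes "0 \<notin># M"
  shows "finite (carrier (cyclic_sum M))"
proof -
  have "{(d, i). i < count M d} \<subseteq> (SIGMA d:set_mset M. {..<count M d})"
    by (auto simp flip: count_greater_zero_iff)
  then have fin: "finite {(d, i). i < count M d}"
    by (rule finite_subset) auto
  have "carrier (cyclic_sum M) \<subseteq> (\<Pi>\<^sub>E e\<in>{(d, i). i < count M d}. carrier (integer_mod_group (fst e)))"
    unfolding cyclic_sum_def by (subst carrier_sum_group) (auto simp: split_beta)
  moreover have "d > 0" if "i < count M d" for d i
    using that assms by (metis gr0I not_in_iff not_less_zero)
  then have "finite (\<Pi>\<^sub>E e\<in>{(d, i). i < count M d}. carrier (integer_mod_group (fst e)))"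
    using fin by (intro finite_PiE) (auto simp: carrier_integer_mod_group)
  ultimately show ?thesis
    by (rule finite_subset)
qed

text \<open>The case \<open>k = 0\<close> of the decomposition, without the summands \<open>\<int>/2^0\<close> and with \<open>\<int>\<close> removed by the root.\<close>

lemma sandpile_group_kautz_iso_cyclic_sum:
  assumes "n \<ge> 1" and r: "r \<in> verts (kautz n)"
  shows "sandpile_group (kautz n) r \<cong>
    cyclic_sum ({#3#} + (replicate_mset 2 (2 ^ (n - 1)) +
      (\<Sum>j\<in>{1..n - 2}. replicate_mset (3 * 2 ^ (n - 2 - j)) (2 ^ j))))" (is "_ \<cong> cyclic_sum ?M")
proof -
  obtain m where n: "n = Suc m"
    using assms by (cases n) auto
  let ?G = "kautz n"
  obtain p q i j where reg: "two_regular_digraph ?G p q i j"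
    and iso_k: "\<And>k. divided_group (verts ?G) (head ?G \<circ> p) (head ?G \<circ> q) k \<cong>
      cyclic_sum ({#0, 3, 2 ^ (k + m), 2 ^ (k + m)#} +
        (\<Sum>l<m. replicate_mset (3 * 2 ^ (m - Suc l)) (2 ^ (k + l))))"
    using divided_group_kautz_iso [of m] unfolding n by blast
  interpret two_regular "verts ?G" "arcs ?G" "tail ?G" "head ?G" p q i j
    by (rule reg)
  have pair: "replicate_mset 2 d = {#d, d#}" for d :: nat
    by (simp add: numeral_2_eq_2)
  have "presented_group (verts ?G) balance_relators \<cong> divided_group (verts ?G) (head ?G \<circ> p) (head ?G \<circ> q) 0"
    using divided_group_0_iso [of "head ?G \<circ> p" "verts ?G" "head ?G \<circ> q"]
    by (simp add: balance_relators_def image_subset_iff hd_closed)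
  also have "divided_group (verts ?G) (head ?G \<circ> p) (head ?G \<circ> q) 0 \<cong>
      cyclic_sum ({#0, 3, 2 ^ m, 2 ^ m#} + (\<Sum>l<m. replicate_mset (3 * 2 ^ (m - Suc l)) (2 ^ l)))"
    using iso_k [of 0] by simp
  also have "cyclic_sum ({#0, 3, 2 ^ m, 2 ^ m#} + (\<Sum>l<m. replicate_mset (3 * 2 ^ (m - Suc l)) (2 ^ l))) \<cong>
      cyclic_sum (?M + {#0#})"
  proof (cases m)
    case 0
    then show ?thesis
      by (simp add: n pair add_mset_commute)
  next
    case (Suc m')
    \<comment> \<open>the terms with \<open>l > 0\<close>; the term with \<open>l = 0\<close> consists of ones, that is, of trivial groups\<close>
    have "(\<Sum>l<m'. replicate_mset (3 * 2 ^ (m' - Suc l)) (2 ^ Suc l)) =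
        (\<Sum>j\<in>{1..m'}. replicate_mset (3 * 2 ^ (m' - j)) (2 ^ j))"
      by (rule sum.reindex_bij_witness [of _ "\<lambda>j. j - 1" Suc]) auto
    then have "{#0, 3, 2 ^ m, 2 ^ m#} + (\<Sum>l<m. replicate_mset (3 * 2 ^ (m - Suc l)) (2 ^ l)) =
        replicate_mset (3 * 2 ^ m') 1 + (?M + {#0#})"
      by (simp add: n Suc sum.lessThan_Suc_shift pair ac_simps del: sum.lessThan_Suc)
    then show ?thesis
      by (simp only: cyclic_sum_drop_ones)
  qed
  also have "\<dots> \<cong> cyclic_sum ?M \<times>\<times> integer_mod_group 0"
  proof -
    have "cyclic_sum ?M \<times>\<times> integer_mod_group 0 \<cong> cyclic_sum (?M + {#0#})"
      by (intro DirProd_iso_cyclic_sum iso_refl cyclic_sum_single group_cyclic_sum group_integer_mod_group)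
    then show ?thesis
      by (rule group.iso_sym [OF DirProd_group [OF group_cyclic_sum group_integer_mod_group]])
  qed
  finally have coker: "presented_group (verts ?G) balance_relators \<cong> cyclic_sum ?M \<times>\<times> integer_mod_group 0" .
  have "0 \<notin># ?M"
    by (auto simp: set_mset_sum split: if_splits)
  moreover have "frag_extend (\<lambda>_. frag_of ()) \<rho> = 0" if "\<rho> \<in> balance_relators" for \<rho>
    using that by (auto simp: balance_relators_def frag_extend_simps frag_cmul_2)
  ultimately have "presented_group (verts ?G) (insert (frag_of r) balance_relators) \<cong> cyclic_sum ?M"
    by (intro presented_group_degree_zero [OF group_cyclic_sum finite_cyclic_sum coker balance_relators_closed r])
  then show ?thesis
    by (simp only: sandpile_group_two_regular [OF reg r])
qed

theorem theorem1p4: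
  fixes n :: nat and r :: "nat nested"
  assumes "n \<ge> 1" and "r \<in> verts (kautz n)"
  shows "sandpile_group (kautz n) r \<cong>
    integer_mod_group 3 \<times>\<times>
    (sum_group {1..2::nat} (\<lambda>_. integer_mod_group (2 ^ (n - 1))) \<times>\<times>
     sum_group {1..n - 2} (\<lambda>j.
       sum_group {1..3 * 2 ^ (n - 2 - j)} (\<lambda>_::nat. integer_mod_group (2 ^ j))))"
    (is "_ \<cong> integer_mod_group 3 \<times>\<times> (?A \<times>\<times> ?B)")
proof -
  let ?M = "replicate_mset 2 (2 ^ (n - 1))"
  let ?N = "\<lambda>j :: nat. replicate_mset (3 * 2 ^ (n - 2 - j)) (2 ^ j)"
  have groups: "group ?A" "group ?B"
    by (auto intro!: sum_group)
  have "?A \<cong> cyclic_sum ?M"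
    using sum_group_const_iso_cyclic_sum [of "{1..2::nat}"] by simp
  moreover have "?B \<cong> cyclic_sum (\<Sum>j\<in>{1..n - 2}. ?N j)"
    using sum_group_const_iso_cyclic_sum [of "{1..3 * 2 ^ (n - 2 - j)} :: nat set" for j]
    by (intro sum_group_iso_cyclic_sum) (auto intro!: sum_group)
  ultimately have "integer_mod_group 3 \<times>\<times> (?A \<times>\<times> ?B) \<cong> cyclic_sum ({#3#} + (?M + (\<Sum>j\<in>{1..n - 2}. ?N j)))"
    using groups by (intro DirProd_iso_cyclic_sum cyclic_sum_single DirProd_group) auto
  then have "cyclic_sum ({#3#} + (?M + (\<Sum>j\<in>{1..n - 2}. ?N j))) \<cong> integer_mod_group 3 \<times>\<times> (?A \<times>\<times> ?B)"
    using groups by (rule group.iso_sym [OF DirProd_group [OF group_integer_mod_group DirProd_group], rotated 2])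
  with sandpile_group_kautz_iso_cyclic_sum [OF assms] show ?thesis
    by (rule iso_trans)
qed

end
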